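(* Let $C$ be a trigonal curve with affine equation $y^3=\prod_{i=1}^r (x-t_i)$. Then $$\operatorname{rank}(\mu_{1|W_1\otimes W_2})=2r-12.$$
   Context: Here $C$ is the smooth projective complex curve with affine equation $y^3=\prod_{i=1}^r(x-t_i)$, with the $t_i$ distinct complex numbers, $t_1=0$, $r\equiv 0\pmod 3$; its genus is $g=r-2$. Let $\pi:C\to\mathbb P^1$, $(x,y)\mapsto x$, be the associated cyclic triple cover, $L=\pi^*\mathcal O_{\mathbb P^1}(1)$ (the line bundle of the $g^1_3$) and $M=K_C\otimes L^\vee$. Identify $L\cong\mathcal O_C(F)$ with $F=\pi^*(0)$, so $H^0(M)$ is the space of holomorphic $1$-forms vanishing on $F$. Then $H^0(M)=W_1\oplus W_2$ with $$W_1=\Big\langle \alpha_i=x^i\tfrac{dx}{y}: 1\le i\le n_1\Big\rangle,\qquad W_2=\Big\langle \beta_j=x^j\tfrac{dx}{y^2}: 1\le j\le n_2\Big\rangle,$$ $n_1=\frac{r-6}{3}$, $n_2=\frac{2r-6}{3}$, so that $\Lambda^2H^0(M)=\Lambda^2W_1\oplus\Lambda^2W_2\oplus (W_1\otimes W_2)$, where $W_1\otimes W_2$ is the span of the $\alpha_i\wedge\beta_j$. The first Gaussian map $\mu_1=\mu_{1,M}:\Lambda^2H^0(M)\to H^0(M^{\otimes 2}\otimes K_C)$ is defined as follows: if in a local coordinate $z$ and a local frame of $M$ the sections $\omega,\eta$ are given by functions $f,h$, then $\mu_1(\omega\wedge\eta)$ is given by $(f'h-fh')\,dz$. The map $\mu_{1|W_1\otimes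 W_2}$ is its restriction to $W_1\otimes W_2$.
   Formalization: Proved for r ≥ 6 divisible by 3 with r ≠ 9: for r = 9 the formula fails, since n_1 = 1 and n_2 = 4 give dim W_1⊗W_2 = 4 < 6 = 2r−12, and for r = 3 the number 2r−12 is negative. *)

theory Defs
  imports
    "HOL-Complex_Analysis.Complex_Analysis"
    "HOL-Library.Function_Algebras"
begin

section \<open>Complex-valued functions as a complex vector space\<close>

definition cscale :: "complex \<Rightarrow> ('q \<Rightarrow> complex) \<Rightarrow> 'q \<Rightarrow> complex" where
  "cscale c f = (\<lambda>q. c * f q)"

lemma cscale_apply [simp]: "cscale c f q = c * f q"
  by (simp add: cscale_def)

interpretation cfun: vector_space "cscale :: complex \<Rightarrow> ('q \<Rightarrow> complex) \<Rightarrow> 'q \<Rightarrow> complex"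
  by unfold_locales (auto simp: cscale_def fun_eq_iff algebra_simps)


section \<open>The cyclic triple cover\<close>

text \<open>
  The smooth projective model of \<open>y^3 = (x - t 1) \<cdots> (x - t r)\<close>, where \<open>3\<close> divides \<open>r\<close>, is glued
  from this plane affine curve and the plane affine curve \<open>v^3 = (1 - t 1 w) \<cdots> (1 - t r w)\<close> along
  \<open>w = 1 / x\<close>, \<open>v = y / x^(r/3)\<close>.  Both are smooth if the \<open>t i\<close> are distinct.  The second one adds
  the three points \<open>w = 0\<close>, \<open>v^3 = 1\<close>.  In terms of the cover \<open>\<pi>\<close> to the projective line, given
  by \<open>x\<close>, the points \<open>At_Inf v\<close> are the fibre over infinity.
\<close>

datatype point = Affine complex complex | At_Inf complex

definition curve :: "(nat \<Rightarrow> complex) \<Rightarrow> nat \<Rightarrow> point set" where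
  "curve t r =
     {Affine x y |x y. y ^ 3 = (\<Prod>i=1..r. x - t i)} \<union> {At_Inf v |v. v ^ 3 = 1}"

text \<open>At the points at infinity, \<open>x\<close> and \<open>y\<close> have poles; the values given there are dummies.\<close>

primrec coord_x :: "point \<Rightarrow> complex" where
  "coord_x (Affine x y) = x"
| "coord_x (At_Inf v) = 0"

primrec coord_y :: "point \<Rightarrow> complex" where
  "coord_y (Affine x y) = y"
| "coord_y (At_Inf v) = 0"

primrec coord_w :: "point \<Rightarrow> complex" where
  "coord_w (Affine x y) = 1 / x"
| "coord_w (At_Inf v) = 0"

primrec coord_v :: "nat \<Rightarrow> point \<Rightarrow> complex" where
  "coord_v r (Affine x y) = y / x ^ (r div 3)"
| "coord_v r (At_Inf v) = v"

definition piece_xy :: "(nat \<Rightarrow> complex) \<Rightarrow> nat \<Rightarrow> point set" where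
  "piece_xy t r = {p \<in> curve t r. p \<notin> range At_Inf}"

definition piece_wv :: "(nat \<Rightarrow> complex) \<Rightarrow> nat \<Rightarrow> point set" where
  "piece_wv t r = {p \<in> curve t r. p \<in> range At_Inf \<or> coord_x p \<noteq> 0}"

text \<open>
  A local coordinate \<open>z\<close> is given by its inverse \<open>\<psi>\<close>, defined on an open set \<open>D\<close> of values of \<open>z\<close>:
  an injective holomorphic immersion of \<open>D\<close> into one of the two smooth plane curves.
\<close>

definition immersion :: "complex set \<Rightarrow> (complex \<Rightarrow> complex) \<Rightarrow> (complex \<Rightarrow> complex) \<Rightarrow> bool" where
  "immersion D a b \<longleftrightarrow> a holomorphic_on D \<and> b holomorphic_on D \<and>
     (\<forall>z\<in>D. deriv a z \<noteq> 0 \<or> deriv b z \<noteq> 0)"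

definition local_coordinate ::
    "(nat \<Rightarrow> complex) \<Rightarrow> nat \<Rightarrow> complex set \<Rightarrow> (complex \<Rightarrow> point) \<Rightarrow> bool" where
  "local_coordinate t r D \<psi> \<longleftrightarrow> open D \<and> inj_on \<psi> D \<and>
     (\<psi> ` D \<subseteq> piece_xy t r \<and> immersion D (coord_x \<circ> \<psi>) (coord_y \<circ> \<psi>) \<or>
      \<psi> ` D \<subseteq> piece_wv t r \<and> immersion D (coord_w \<circ> \<psi>) (coord_v r \<circ> \<psi>))"


section \<open>The line bundle \<open>M = K(-F)\<close> and its sections\<close>

text \<open>
  \<open>F\<close> is the pullback under \<open>\<pi>\<close> of the divisor \<open>0\<close> of the projective line.  The ideal sheaf of the
  point \<open>0\<close> is generated by \<open>x\<close> where \<open>x\<close> is finite and by \<open>1\<close> where \<open>x\<close> is nonzero, so \<open>O(-F)\<close>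
  is generated by the pullbacks of these functions.
\<close>

definition generates_ideal_F ::
    "(nat \<Rightarrow> complex) \<Rightarrow> nat \<Rightarrow> complex set \<Rightarrow> (complex \<Rightarrow> point) \<Rightarrow> (complex \<Rightarrow> complex) \<Rightarrow> bool" where
  "generates_ideal_F t r D \<psi> u \<longleftrightarrow> u holomorphic_on D \<and>
     (\<psi> ` D \<subseteq> piece_xy t r \<longrightarrow>
        (\<exists>g. g holomorphic_on D \<and> (\<forall>z\<in>D. g z \<noteq> 0 \<and> u z = g z * coord_x (\<psi> z)))) \<and>
     (\<psi> ` D \<subseteq> piece_wv t r \<longrightarrow> (\<forall>z\<in>D. u z \<noteq> 0))"

text \<open>
  A trivialisation \<open>(D, \<psi>, u)\<close> consists of a local coordinate \<open>z\<close> and of the local frame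
  \<open>e = u dz\<close> of \<open>M = K \<otimes> O(-F)\<close>.
\<close>

type_synonym triv = "complex set \<times> (complex \<Rightarrow> point) \<times> (complex \<Rightarrow> complex)"

definition trivialisation :: "(nat \<Rightarrow> complex) \<Rightarrow> nat \<Rightarrow> triv \<Rightarrow> bool" where
  "trivialisation t r = (\<lambda>(D, \<psi>, u). local_coordinate t r D \<psi> \<and> generates_ideal_F t r D \<psi> u)"

definition patches :: "(nat \<Rightarrow> complex) \<Rightarrow> nat \<Rightarrow> (triv \<times> complex) set" where
  "patches t r = {(\<tau>, z). trivialisation t r \<tau> \<and> z \<in> fst \<tau>}"

text \<open>
  A holomorphic section of \<open>M^a \<otimes> K^b\<close> is given by its components \<open>s (\<tau>, z)\<close> with respect to
  \<open>e^a \<otimes> dz^b\<close> for all trivialisations \<open>\<tau>\<close>.  If \<open>z' = h z\<close> is a change of coordinate then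
  \<open>e^a \<otimes> dz^b\<close> and \<open>e'^a \<otimes> dz'^b\<close> are \<open>u^a dz^(a+b)\<close> and
  \<open>u'(h z)^a h'(z)^(a+b) dz^(a+b)\<close> as differentials of degree \<open>a + b\<close>.  At a zero of \<open>u\<close> the
  transformation law below is void, but there the correct one follows by continuity.
\<close>

type_synonym bundle_section = "triv \<times> complex \<Rightarrow> complex"

definition sections :: "(nat \<Rightarrow> complex) \<Rightarrow> nat \<Rightarrow> nat \<Rightarrow> nat \<Rightarrow> bundle_section set" where
  "sections t r a b = {s.
     (\<forall>q. q \<notin> patches t r \<longrightarrow> s q = 0) \<and>
     (\<forall>\<tau>. trivialisation t r \<tau> \<longrightarrow> (\<lambda>z. s (\<tau>, z)) holomorphic_on fst \<tau>) \<and>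
     (\<forall>D \<psi> u D' \<psi>' u' N h.
        trivialisation t r (D, \<psi>, u) \<and> trivialisation t r (D', \<psi>', u') \<and>
        open N \<and> N \<subseteq> D \<and> h holomorphic_on N \<and> h ` N \<subseteq> D' \<and> (\<forall>z\<in>N. \<psi>' (h z) = \<psi> z) \<longrightarrow>
        (\<forall>z\<in>N. s ((D, \<psi>, u), z) * u z ^ a =
                s ((D', \<psi>', u'), h z) * u' (h z) ^ a * deriv h z ^ (a + b)))}"

lemma sections_holomorphic:
  assumes "s \<in> sections t r a b" "trivialisation t r (D, \<psi>, u)"
  shows "(\<lambda>z. s ((D, \<psi>, u), z)) holomorphic_on D"
proof -
  have "(\<lambda>z. s ((D, \<psi>, u), z)) holomorphic_on fst (D, \<psi>, u)"
    using assms unfolding sections_def mem_Collect_eq by blast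
  then show ?thesis by simp
qed

lemma sections_transition:
  assumes "s \<in> sections t r a b"
    and "trivialisation t r (D, \<psi>, u)" "trivialisation t r (D', \<psi>', u')"
    and "open N" "N \<subseteq> D" "h holomorphic_on N" "h ` N \<subseteq> D'" "\<forall>z\<in>N. \<psi>' (h z) = \<psi> z" "z \<in> N"
  shows "s ((D, \<psi>, u), z) * u z ^ a = s ((D', \<psi>', u'), h z) * u' (h z) ^ a * deriv h z ^ (a + b)"
proof -
  from assms(1) have "\<forall>D \<psi> u D' \<psi>' u' N h.
        trivialisation t r (D, \<psi>, u) \<and> trivialisation t r (D', \<psi>', u') \<and>
        open N \<and> N \<subseteq> D \<and> h holomorphic_on N \<and> h ` N \<subseteq> D' \<and> (\<forall>z\<in>N. \<psi>' (h z) = \<psi> z) \<longrightarrow>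
        (\<forall>z\<in>N. s ((D, \<psi>, u), z) * u z ^ a =
                s ((D', \<psi>', u'), h z) * u' (h z) ^ a * deriv h z ^ (a + b))"
    unfolding sections_def mem_Collect_eq by (elim conjE)
  from this[THEN spec, THEN spec, THEN spec, THEN spec, THEN spec, THEN spec, THEN spec, THEN spec,
      THEN mp, THEN bspec, of D \<psi> u D' \<psi>' u' N h z]
  show ?thesis using assms by (simp only: simp_thms)
qed

abbreviation H0_M :: "(nat \<Rightarrow> complex) \<Rightarrow> nat \<Rightarrow> bundle_section set" where
  "H0_M t r \<equiv> sections t r 1 0"

abbreviation H0_M2K :: "(nat \<Rightarrow> complex) \<Rightarrow> nat \<Rightarrow> bundle_section set" where
  "H0_M2K t r \<equiv> sections t r 2 1"

text \<open>
  The meromorphic form \<open>G(x, y) dx\<close> as a section of \<open>M\<close>, with its removable singularities removed.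
\<close>

definition form_dx :: "(nat \<Rightarrow> complex) \<Rightarrow> nat \<Rightarrow> (complex \<Rightarrow> complex \<Rightarrow> complex) \<Rightarrow> bundle_section" where
  "form_dx t r G = (\<lambda>((D, \<psi>, u), z).
     if ((D, \<psi>, u), z) \<in> patches t r
     then remove_sings
       (\<lambda>\<zeta>. G (coord_x (\<psi> \<zeta>)) (coord_y (\<psi> \<zeta>)) * deriv (coord_x \<circ> \<psi>) \<zeta> / u \<zeta>) z
     else 0)"

definition alpha :: "(nat \<Rightarrow> complex) \<Rightarrow> nat \<Rightarrow> nat \<Rightarrow> bundle_section" where
  "alpha t r i = form_dx t r (\<lambda>x y. x ^ i / y)"

definition beta :: "(nat \<Rightarrow> complex) \<Rightarrow> nat \<Rightarrow> nat \<Rightarrow> bundle_section" where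
  "beta t r j = form_dx t r (\<lambda>x y. x ^ j / y ^ 2)"

definition W1 :: "(nat \<Rightarrow> complex) \<Rightarrow> nat \<Rightarrow> bundle_section set" where
  "W1 t r = cfun.span (alpha t r ` {1..(r - 6) div 3})"

definition W2 :: "(nat \<Rightarrow> complex) \<Rightarrow> nat \<Rightarrow> bundle_section set" where
  "W2 t r = cfun.span (beta t r ` {1..(2 * r - 6) div 3})"


section \<open>Exterior square\<close>

text \<open>
  For a space \<open>V\<close> of functions on \<open>Q\<close>, the map from \<open>V \<otimes> V\<close> to functions on \<open>Q \<times> Q\<close> is injective;
  the exterior square of \<open>V\<close> is realised there as the space of alternating tensors.
\<close>

definition wedge :: "('q \<Rightarrow> complex) \<Rightarrow> ('q \<Rightarrow> complex) \<Rightarrow> 'q \<times> 'q \<Rightarrow> complex" where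
  "wedge f h = (\<lambda>(p, q). f p * h q - f q * h p)"

definition ext_square :: "('q \<Rightarrow> complex) set \<Rightarrow> ('q \<times> 'q \<Rightarrow> complex) set" where
  "ext_square V = cfun.span {wedge f h |f h. f \<in> V \<and> h \<in> V}"

text \<open>The summand of the exterior square of \<open>A \<oplus> B\<close> that is isomorphic to \<open>A \<otimes> B\<close>.\<close>

definition mixed_wedge ::
    "('q \<Rightarrow> complex) set \<Rightarrow> ('q \<Rightarrow> complex) set \<Rightarrow> ('q \<times> 'q \<Rightarrow> complex) set" where
  "mixed_wedge A B = cfun.span {wedge f h |f h. f \<in> A \<and> h \<in> B}"

lemma mixed_wedge_span:
  "mixed_wedge (cfun.span A) (cfun.span B) = cfun.span {wedge f h |f h. f \<in> A \<and> h \<in> B}"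
  (is "_ = cfun.span ?S")
proof -
  have 1: "wedge f h \<in> cfun.span ?S" if f: "f \<in> A" and h: "h \<in> cfun.span B" for f h
    using h
  proof (induction rule: cfun.span_induct_alt)
    case base
    have "wedge f 0 = 0" by (auto simp: wedge_def fun_eq_iff)
    then show ?case by (simp only: cfun.span_zero)
  next
    case (step c x y)
    have "wedge f (cscale c x + y) = cscale c (wedge f x) + wedge f y"
      by (auto simp: wedge_def fun_eq_iff algebra_simps)
    moreover have "wedge f x \<in> cfun.span ?S"
      using f step by (intro cfun.span_base) blast
    ultimately show ?case
      using step.IH by (simp only: cfun.span_add cfun.span_scale)
  qed
  have 2: "wedge f h \<in> cfun.span ?S" if f: "f \<in> cfun.span A" and h: "h \<in> cfun.span B" for f h
    using f
  proof (induction rule: cfun.span_induct_alt)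
    case base
    have "wedge 0 h = 0" by (auto simp: wedge_def fun_eq_iff)
    then show ?case by (simp only: cfun.span_zero)
  next
    case (step c x y)
    have "wedge (cscale c x + y) h = cscale c (wedge x h) + wedge y h"
      by (auto simp: wedge_def fun_eq_iff algebra_simps)
    moreover have "wedge x h \<in> cfun.span ?S"
      using 1[OF step.hyps(1) h] .
    ultimately show ?case
      using step.IH by (simp only: cfun.span_add cfun.span_scale)
  qed
  show ?thesis
    unfolding mixed_wedge_def
  proof (rule antisym)
    show "cfun.span {wedge f h |f h. f \<in> cfun.span A \<and> h \<in> cfun.span B} \<subseteq> cfun.span ?S"
      by (rule cfun.span_minimal) (use 2 in auto)
    show "cfun.span ?S \<subseteq> cfun.span {wedge f h |f h. f \<in> cfun.span A \<and> h \<in> cfun.span B}"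
      by (rule cfun.span_mono) (use cfun.span_base in blast)
  qed
qed


section \<open>The first Gaussian map of \<open>M\<close>\<close>

text \<open>The value of the Gaussian map on a decomposable element, \<open>(f' h - f h') dz\<close>.\<close>

definition gauss_wronskian :: "(nat \<Rightarrow> complex) \<Rightarrow> nat \<Rightarrow> bundle_section \<Rightarrow> bundle_section \<Rightarrow> bundle_section" where
  "gauss_wronskian t r \<omega> \<eta> = (\<lambda>(\<tau>, z).
     if (\<tau>, z) \<in> patches t r
     then (let f = (\<lambda>\<zeta>. \<omega> (\<tau>, \<zeta>)); h = (\<lambda>\<zeta>. \<eta> (\<tau>, \<zeta>)) in deriv f z * h z - f z * deriv h z)
     else 0)"

text \<open>
  The Gaussian map is determined by the following on the exterior square of \<open>H0_M t r\<close>; its values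
  elsewhere are irrelevant.
\<close>

definition is_gauss_map ::
    "(nat \<Rightarrow> complex) \<Rightarrow> nat \<Rightarrow> (((triv \<times> complex) \<times> (triv \<times> complex) \<Rightarrow> complex) \<Rightarrow> bundle_section) \<Rightarrow> bool" where
  "is_gauss_map t r \<mu> \<longleftrightarrow> Vector_Spaces.linear cscale cscale \<mu> \<and>
     (\<forall>\<omega>\<in>H0_M t r. \<forall>\<eta>\<in>H0_M t r. \<mu> (wedge \<omega> \<eta>) = gauss_wronskian t r \<omega> \<eta>)"

definition gauss_map ::
    "(nat \<Rightarrow> complex) \<Rightarrow> nat \<Rightarrow> ((triv \<times> complex) \<times> (triv \<times> complex) \<Rightarrow> complex) \<Rightarrow> bundle_section" where
  "gauss_map t r = (SOME \<mu>. is_gauss_map t r \<mu>)"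

interpretation cfun_pair: vector_space_pair
  "cscale :: complex \<Rightarrow> ('p \<Rightarrow> complex) \<Rightarrow> 'p \<Rightarrow> complex"
  "cscale :: complex \<Rightarrow> ('q \<Rightarrow> complex) \<Rightarrow> 'q \<Rightarrow> complex"
  by unfold_locales

text \<open>Existence: on the exterior square, the map is the derivative along the first factor,
  restricted to the diagonal.\<close>

lemma is_gauss_map_exists: "\<exists>\<mu>. is_gauss_map t r \<mu>"
proof -
  define L :: "((triv \<times> complex) \<times> (triv \<times> complex) \<Rightarrow> complex) \<Rightarrow> bundle_section" where
    "L T = (\<lambda>(\<tau>, z). if (\<tau>, z) \<in> patches t r
      then deriv (\<lambda>\<zeta>. T ((\<tau>, \<zeta>), (\<tau>, z))) z else 0)" for T
  define V where "V = {wedge \<omega> \<eta> |\<omega> \<eta>. \<omega> \<in> H0_M t r \<and> \<eta> \<in> H0_M t r}"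
  define P :: "((triv \<times> complex) \<times> (triv \<times> complex) \<Rightarrow> complex) \<Rightarrow> bool" where
    "P T \<longleftrightarrow> (\<forall>\<tau> z. (\<tau>, z) \<in> patches t r \<longrightarrow>
      (\<lambda>\<zeta>. T ((\<tau>, \<zeta>), (\<tau>, z))) field_differentiable at z)" for T
  have P_deriv: "((\<lambda>\<zeta>. T ((\<tau>, \<zeta>), (\<tau>, z))) has_field_derivative L T (\<tau>, z)) (at z)"
    if "P T" "(\<tau>, z) \<in> patches t r" for T \<tau> z
  proof -
    have "(\<lambda>\<zeta>. T ((\<tau>, \<zeta>), (\<tau>, z))) field_differentiable at z"
      using that unfolding P_def by blast
    then show ?thesis
      using that(2) by (simp add: L_def field_differentiable_derivI)
  qed
  have diff: "(\<lambda>\<zeta>. \<omega> (\<tau>, \<zeta>)) field_differentiable at z"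
    if "\<omega> \<in> H0_M t r" "(\<tau>, z) \<in> patches t r" for \<omega> \<tau> z
  proof -
    have "trivialisation t r \<tau>" "z \<in> fst \<tau>" using that by (auto simp: patches_def)
    moreover from this have "open (fst \<tau>)"
      by (auto simp: trivialisation_def local_coordinate_def split: prod.splits)
    moreover have "(\<lambda>\<zeta>. \<omega> (\<tau>, \<zeta>)) holomorphic_on fst \<tau>"
      using that calculation(1) unfolding sections_def mem_Collect_eq by blast
    ultimately show ?thesis
      using holomorphic_on_imp_differentiable_at by blast
  qed
  have L_wedge: "P (wedge \<omega> \<eta>) \<and> L (wedge \<omega> \<eta>) = gauss_wronskian t r \<omega> \<eta>"
    if "\<omega> \<in> H0_M t r" "\<eta> \<in> H0_M t r" for \<omega> \<eta>
  proof -
    have *: "((\<lambda>\<zeta>. wedge \<omega> \<eta> ((\<tau>, \<zeta>), (\<tau>, z))) has_field_derivative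
        deriv (\<lambda>\<zeta>. \<omega> (\<tau>, \<zeta>)) z * \<eta> (\<tau>, z) - \<omega> (\<tau>, z) * deriv (\<lambda>\<zeta>. \<eta> (\<tau>, \<zeta>)) z) (at z)"
      if "(\<tau>, z) \<in> patches t r" for \<tau> z
      using diff[OF \<open>\<omega> \<in> H0_M t r\<close> that] diff[OF \<open>\<eta> \<in> H0_M t r\<close> that]
      by (auto simp: wedge_def intro!: derivative_eq_intros
          dest!: field_differentiable_derivI)
    show ?thesis
    proof
      show "P (wedge \<omega> \<eta>)"
        unfolding P_def field_differentiable_def using * by blast
      show "L (wedge \<omega> \<eta>) = gauss_wronskian t r \<omega> \<eta>"
        unfolding L_def gauss_wronskian_def Let_def
        by (intro ext) (simp add: DERIV_imp_deriv[OF *] split: prod.split)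
    qed
  qed
  obtain B where B: "B \<subseteq> V" "cfun.independent B" "V \<subseteq> cfun.span B"
    using cfun.maximal_independent_subset[of V] by blast
  obtain g where g: "Vector_Spaces.linear cscale cscale g" "\<forall>b\<in>B. g b = L b"
    using cfun_pair.linear_independent_extend[OF B(2), of L] by blast
  interpret g: Vector_Spaces.linear cscale cscale g by (fact g(1))
  have "P T \<and> g T = L T" if "T \<in> cfun.span B" for T
    using that
  proof (induction rule: cfun.span_induct_alt)
    case base
    have "L 0 = 0" by (intro ext) (simp add: L_def split: prod.split)
    then have "g 0 = L 0" by (simp only: g.zero)
    moreover have "P 0" by (simp add: P_def)
    ultimately show ?case by blast
  next
    case (step c S T)
    from step.hyps(1) have "g S = L S"
      using g(2) by blast
    from step.hyps(1) have "P S"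
      using B(1) L_wedge unfolding V_def by blast
    have *: "((\<lambda>\<zeta>. (cscale c S + T) ((\<tau>, \<zeta>), (\<tau>, z))) has_field_derivative
        c * L S (\<tau>, z) + L T (\<tau>, z)) (at z)" if "(\<tau>, z) \<in> patches t r" for \<tau> z
    proof -
      have "((\<lambda>\<zeta>. S ((\<tau>, \<zeta>), (\<tau>, z))) has_field_derivative L S (\<tau>, z)) (at z)"
        using P_deriv \<open>P S\<close> that by blast
      moreover have "((\<lambda>\<zeta>. T ((\<tau>, \<zeta>), (\<tau>, z))) has_field_derivative L T (\<tau>, z)) (at z)"
        using P_deriv step.IH that by blast
      ultimately show ?thesis
        by (auto intro!: derivative_eq_intros)
    qed
    have "P (cscale c S + T)"
      unfolding P_def field_differentiable_def using * by blast
    moreover have "L (cscale c S + T) = cscale c (L S) + L T"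
    proof
      fix q :: "triv \<times> complex"
      obtain \<tau> z where q: "q = (\<tau>, z)" by (cases q) auto
      show "L (cscale c S + T) q = (cscale c (L S) + L T) q"
      proof (cases "(\<tau>, z) \<in> patches t r")
        case True
        have "L (cscale c S + T) q = deriv (\<lambda>\<zeta>. (cscale c S + T) ((\<tau>, \<zeta>), (\<tau>, z))) z"
          using True by (simp add: L_def q)
        also have "\<dots> = c * L S (\<tau>, z) + L T (\<tau>, z)"
          by (rule DERIV_imp_deriv[OF *[OF True]])
        finally show ?thesis by (simp add: q)
      qed (simp add: L_def q)
    qed
    moreover have "g (cscale c S + T) = cscale c (L S) + L T"
      using step.IH \<open>g S = L S\<close> by (simp only: g.add g.scale)
    ultimately show ?case
      by (simp only: simp_thms)
  qed
  moreover have "wedge \<omega> \<eta> \<in> cfun.span B" if "\<omega> \<in> H0_M t r" "\<eta> \<in> H0_M t r" for \<omega> \<eta>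
    using that B(3) unfolding V_def by blast
  ultimately have "g (wedge \<omega> \<eta>) = gauss_wronskian t r \<omega> \<eta>"
    if "\<omega> \<in> H0_M t r" "\<eta> \<in> H0_M t r" for \<omega> \<eta>
    using that by (simp only: L_wedge)
  then show ?thesis
    unfolding is_gauss_map_def using g(1) by blast
qed

lemma is_gauss_map_gauss_map: "is_gauss_map t r (gauss_map t r)"
  unfolding gauss_map_def by (rule someI_ex[OF is_gauss_map_exists])

lemma gauss_wronskian_section:
  assumes "\<omega> \<in> H0_M t r" "\<eta> \<in> H0_M t r"
  shows "gauss_wronskian t r \<omega> \<eta> \<in> H0_M2K t r"
proof -
  have open_D: "open D" if "trivialisation t r (D, \<psi>, u)" for D \<psi> u
    using that by (auto simp: trivialisation_def local_coordinate_def)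
  have u_hol: "u holomorphic_on D" if "trivialisation t r (D, \<psi>, u)" for D \<psi> u
    using that by (auto simp: trivialisation_def generates_ideal_F_def)
  have hol: "(\<lambda>\<zeta>. \<sigma> ((D, \<psi>, u), \<zeta>)) holomorphic_on D"
    if "\<sigma> \<in> H0_M t r" "trivialisation t r (D, \<psi>, u)" for \<sigma> D \<psi> u
    using that by (rule sections_holomorphic)
  have W: "gauss_wronskian t r \<omega> \<eta> ((D, \<psi>, u), z) =
      deriv (\<lambda>\<zeta>. \<omega> ((D, \<psi>, u), \<zeta>)) z * \<eta> ((D, \<psi>, u), z) -
      \<omega> ((D, \<psi>, u), z) * deriv (\<lambda>\<zeta>. \<eta> ((D, \<psi>, u), \<zeta>)) z"
    if "trivialisation t r (D, \<psi>, u)" "z \<in> D" for D \<psi> u z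
    using that by (simp add: gauss_wronskian_def patches_def)
  have trans: "gauss_wronskian t r \<omega> \<eta> ((D, \<psi>, u), z) * u z ^ 2 =
      gauss_wronskian t r \<omega> \<eta> ((D', \<psi>', u'), h z) * u' (h z) ^ 2 * deriv h z ^ (2 + 1)"
    if \<tau>: "trivialisation t r (D, \<psi>, u)" and \<tau>': "trivialisation t r (D', \<psi>', u')"
      and N: "open N" "N \<subseteq> D" and h: "h holomorphic_on N" "h ` N \<subseteq> D'"
      and gl: "\<forall>z\<in>N. \<psi>' (h z) = \<psi> z" and z: "z \<in> N"
    for D \<psi> u D' \<psi>' u' N h z
  proof -
    have zD: "z \<in> D" and hz: "h z \<in> D'" using N h z by auto
    define U where "U = deriv u z"
    define U' where "U' = deriv u' (h z)"
    have du: "(u has_field_derivative U) (at z)"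
      unfolding U_def using holomorphic_derivI[OF u_hol[OF \<tau>] open_D[OF \<tau>] zD] .
    have du': "(u' has_field_derivative U') (at (h z))"
      unfolding U'_def using holomorphic_derivI[OF u_hol[OF \<tau>'] open_D[OF \<tau>'] hz] .
    have dh: "(h has_field_derivative deriv h z) (at z)"
      using holomorphic_derivI[OF h(1) N(1) z] .
    have ddh: "(deriv h has_field_derivative deriv (deriv h) z) (at z)"
      using holomorphic_derivI[OF holomorphic_deriv[OF h(1) N(1)] N(1) z] .
    have key: "\<sigma> ((D, \<psi>, u), z) * u z = \<sigma> ((D', \<psi>', u'), h z) * u' (h z) * deriv h z \<and>
        deriv (\<lambda>\<zeta>. \<sigma> ((D, \<psi>, u), \<zeta>)) z * u z + \<sigma> ((D, \<psi>, u), z) * U =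
        (deriv (\<lambda>\<zeta>. \<sigma> ((D', \<psi>', u'), \<zeta>)) (h z) * u' (h z) + \<sigma> ((D', \<psi>', u'), h z) * U')
          * deriv h z ^ 2
        + \<sigma> ((D', \<psi>', u'), h z) * u' (h z) * deriv (deriv h) z"
      if \<sigma>: "\<sigma> \<in> H0_M t r" for \<sigma>
    proof -
      have tr: "\<sigma> ((D, \<psi>, u), \<zeta>) * u \<zeta> = \<sigma> ((D', \<psi>', u'), h \<zeta>) * u' (h \<zeta>) * deriv h \<zeta>"
        if "\<zeta> \<in> N" for \<zeta>
      proof -
        have "\<sigma> ((D, \<psi>, u), \<zeta>) * u \<zeta> ^ 1 =
                \<sigma> ((D', \<psi>', u'), h \<zeta>) * u' (h \<zeta>) ^ 1 * deriv h \<zeta> ^ (1 + 0)"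
          by (rule sections_transition[OF \<sigma> \<tau> \<tau>' N h gl that])
        then show ?thesis by simp
      qed
      have d1: "((\<lambda>\<zeta>. \<sigma> ((D, \<psi>, u), \<zeta>)) has_field_derivative
          deriv (\<lambda>\<zeta>. \<sigma> ((D, \<psi>, u), \<zeta>)) z) (at z)"
        using holomorphic_derivI[OF hol[OF \<sigma> \<tau>] open_D[OF \<tau>] zD] .
      have d2: "((\<lambda>\<zeta>. \<sigma> ((D', \<psi>', u'), \<zeta>)) has_field_derivative
          deriv (\<lambda>\<zeta>. \<sigma> ((D', \<psi>', u'), \<zeta>)) (h z)) (at (h z))"
        using holomorphic_derivI[OF hol[OF \<sigma> \<tau>'] open_D[OF \<tau>'] hz] .
      have l: "((\<lambda>\<zeta>. \<sigma> ((D, \<psi>, u), \<zeta>) * u \<zeta>) has_field_derivative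
          deriv (\<lambda>\<zeta>. \<sigma> ((D, \<psi>, u), \<zeta>)) z * u z + U * \<sigma> ((D, \<psi>, u), z)) (at z)"
        by (rule DERIV_mult'[OF d1 du, THEN DERIV_cong]) simp
      have "((\<lambda>\<zeta>. \<sigma> ((D', \<psi>', u'), h \<zeta>) * u' (h \<zeta>) * deriv h \<zeta>) has_field_derivative
          (deriv (\<lambda>\<zeta>. \<sigma> ((D', \<psi>', u'), \<zeta>)) (h z) * u' (h z) + \<sigma> ((D', \<psi>', u'), h z) * U')
          * deriv h z ^ 2
        + \<sigma> ((D', \<psi>', u'), h z) * u' (h z) * deriv (deriv h) z) (at z)"
        by (rule DERIV_cong[OF DERIV_mult'[OF DERIV_mult'[OF DERIV_chain2[OF d2 dh]
                DERIV_chain2[OF du' dh]] ddh]])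
           (simp add: algebra_simps power2_eq_square)
      then have "((\<lambda>\<zeta>. \<sigma> ((D, \<psi>, u), \<zeta>) * u \<zeta>) has_field_derivative
          (deriv (\<lambda>\<zeta>. \<sigma> ((D', \<psi>', u'), \<zeta>)) (h z) * u' (h z) + \<sigma> ((D', \<psi>', u'), h z) * U')
          * deriv h z ^ 2
        + \<sigma> ((D', \<psi>', u'), h z) * u' (h z) * deriv (deriv h) z) (at z)"
        by (rule has_field_derivative_transform_within_open[OF _ N(1) z]) (simp add: tr)
      from DERIV_unique[OF l this] tr[OF z] show ?thesis by (simp add: mult.commute)
    qed
    define a where "a = \<omega> ((D, \<psi>, u), z)"
    define b where "b = \<eta> ((D, \<psi>, u), z)"
    define a1 where "a1 = deriv (\<lambda>\<zeta>. \<omega> ((D, \<psi>, u), \<zeta>)) z"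
    define b1 where "b1 = deriv (\<lambda>\<zeta>. \<eta> ((D, \<psi>, u), \<zeta>)) z"
    define c where "c = \<omega> ((D', \<psi>', u'), h z)"
    define d where "d = \<eta> ((D', \<psi>', u'), h z)"
    define c1 where "c1 = deriv (\<lambda>\<zeta>. \<omega> ((D', \<psi>', u'), \<zeta>)) (h z)"
    define d1 where "d1 = deriv (\<lambda>\<zeta>. \<eta> ((D', \<psi>', u'), \<zeta>)) (h z)"
    define k where "k = deriv h z"
    define k1 where "k1 = deriv (deriv h) z"
    define v where "v = u' (h z)"
    note defs = a_def b_def a1_def b1_def c_def d_def c1_def d1_def k_def k1_def v_def
    have e: "a * u z = c * v * k" "a1 * u z + a * U = (c1 * v + c * U') * k ^ 2 + c * v * k1"
      "b * u z = d * v * k" "b1 * u z + b * U = (d1 * v + d * U') * k ^ 2 + d * v * k1"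
      using key[OF assms(1)] key[OF assms(2)] by (simp_all add: defs)
    have "(a1 * b - a * b1) * u z ^ 2 =
        (a1 * u z + a * U) * (b * u z) - (a * u z) * (b1 * u z + b * U)"
      by (simp add: algebra_simps power2_eq_square)
    also have "\<dots> = (c1 * d - c * d1) * v ^ 2 * k ^ 3"
      unfolding e by (simp add: algebra_simps power2_eq_square power3_eq_cube)
    finally show ?thesis
      unfolding W[OF \<tau> zD] W[OF \<tau>' hz] by (simp add: defs)
  qed
  have "(\<lambda>z. gauss_wronskian t r \<omega> \<eta> (\<tau>, z)) holomorphic_on fst \<tau>"
    if "trivialisation t r \<tau>" for \<tau>
  proof -
    obtain D \<psi> u where \<tau>: "\<tau> = (D, \<psi>, u)" by (cases \<tau>) auto
    have t: "trivialisation t r (D, \<psi>, u)" using that \<tau> by simp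
    have "(\<lambda>z. deriv (\<lambda>\<zeta>. \<omega> ((D, \<psi>, u), \<zeta>)) z * \<eta> ((D, \<psi>, u), z) -
      \<omega> ((D, \<psi>, u), z) * deriv (\<lambda>\<zeta>. \<eta> ((D, \<psi>, u), \<zeta>)) z) holomorphic_on D"
      by (intro holomorphic_intros holomorphic_deriv hol assms t open_D[OF t])
    from holomorphic_transform[OF this] show ?thesis
      using W[OF t] by (simp add: \<tau>)
  qed
  moreover have "gauss_wronskian t r \<omega> \<eta> q = 0" if "q \<notin> patches t r" for q
    using that by (auto simp: gauss_wronskian_def split: prod.splits)
  ultimately show ?thesis
    unfolding sections_def mem_Collect_eq
    by (intro conjI allI impI ballI) (blast, blast, elim conjE, rule trans)
qed

end

theory Submission
  imports Defs "HOL-Computational_Algebra.Fundamental_Theorem_Algebra"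
begin

text \<open>
  Write \<open>P = (x - t 1) \<cdots> (x - t r)\<close>, so that \<open>y^3 = P\<close> and \<open>y'/y = P'/(3 P)\<close> on the curve.  The
  logarithmic derivative of \<open>\<alpha> i / \<beta> j = x^(i-j) y\<close> turns the Gaussian map into
  \<open>\<mu> (\<alpha> i \<wedge> \<beta> j) = x^(i+j-1) ((i - j) P + x P'/3) / P^2 (dx)^3\<close>,
  so \<open>\<mu>\<close> takes its values on \<open>W1 \<otimes> W2\<close> in a space of polynomials in \<open>x\<close>, times a fixed differential,
  and the rank is the dimension of the span of the numerators (\<open>gauss_poly\<close>).  Let \<open>r = 3 m\<close>, so
  that \<open>1 \<le> i \<le> m - 2\<close> and \<open>1 \<le> j \<le> 2 m - 2\<close>, and fix \<open>s = i + j\<close>.  If two different pairs have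
  this sum, the difference \<open>i - j\<close> varies and the numerators span \<open>x^(s-1) P\<close> and \<open>x^s P'\<close>; if there
  is one pair, they span a line.  For \<open>m \<ge> 4\<close> there is one pair for \<open>s = 2\<close> and for \<open>s = 3 m - 4\<close>,
  and there are several for the \<open>3 m - 7\<close> values between them, which gives
  \<open>2 (3 m - 7) + 2 = 2 r - 12\<close> polynomials.  They are independent
  (\<open>gauss_polys_independent\<close>): a relation between them reads \<open>A P + B P' = 0\<close> with \<open>deg B < r\<close>, and
  because the roots of \<open>P\<close> are simple, \<open>B\<close> vanishes at all \<open>r\<close> of them; hence \<open>B = 0\<close> and \<open>A = 0\<close>.
  For \<open>m = 2\<close> the space \<open>W1\<close> is zero and so is \<open>2 r - 12\<close>.  The value \<open>m = 3\<close> is exceptional: there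
  \<open>i = 1\<close>, and the four pairs \<open>(1, j)\<close> cannot give rank \<open>6\<close>.

  All analytic questions are settled at the generic points of the curve, those at finite distance
  with \<open>x \<noteq> 0\<close> and \<open>y \<noteq> 0\<close>.  There are only finitely many others, and local coordinates are
  injective, so two holomorphic functions of a local coordinate agree if they agree at generic
  points.  What remains is that \<open>\<alpha> i\<close> and \<open>\<beta> j\<close> extend over the other points
  (\<open>form_extends\<close>) and that a section that comes from a polynomial determines it and is
  determined by it (\<open>represents\<close>).
\<close>

section \<open>Families of functions and finite exceptional sets\<close>

text \<open>
  Stated for a family and not for a set, so that the members need not be known to be distinct
  in advance: two equal members would satisfy a nontrivial relation.
\<close>

lemma dim_span_family:
  fixes v :: "'k \<Rightarrow> 'q \<Rightarrow> complex"
  assumes "finite K"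
    and zero: "\<And>c k. (\<Sum>k\<in>K. cscale (c k) (v k)) = 0 \<Longrightarrow> k \<in> K \<Longrightarrow> c k = 0"
  shows "cfun.dim (cfun.span (v ` K)) = card K"
proof -
  have inj: "inj_on v K"
  proof (rule inj_onI, rule ccontr)
    fix k l assume kl: "k \<in> K" "l \<in> K" "v k = v l" "k \<noteq> l"
    define c :: "'k \<Rightarrow> complex" where "c = (\<lambda>m. if m = k then 1 else if m = l then -1 else 0)"
    have "(\<Sum>m\<in>K. cscale (c m) (v m)) = (\<Sum>m\<in>{k, l}. cscale (c m) (v m))"
      using kl \<open>finite K\<close> by (intro sum.mono_neutral_right) (auto simp: c_def fun_eq_iff)
    also have "\<dots> = 0"
      using kl by (simp add: c_def fun_eq_iff)
    finally have "c k = 0" using zero kl(1) by blast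
    then show False by (simp add: c_def)
  qed
  have "cfun.independent (v ` K)"
  proof (rule cfun.independent_if_scalars_zero)
    fix f w assume f: "(\<Sum>x\<in>v ` K. cscale (f x) x) = 0" and w: "w \<in> v ` K"
    have "(\<Sum>k\<in>K. cscale (f (v k)) (v k)) = 0"
      using f by (simp add: sum.reindex[OF inj])
    then show "f w = 0" using zero[of "f \<circ> v"] w by auto
  qed (use \<open>finite K\<close> in simp)
  then have "cfun.dim (cfun.span (v ` K)) = card (v ` K)"
    by (rule cfun.dim_span_eq_card_independent)
  with inj show ?thesis by (simp add: card_image)
qed

lemma continuous_eq_off_finite:
  fixes f g :: "complex \<Rightarrow> complex"
  assumes "open D" "finite E" "continuous_on D f" "continuous_on D g"
    and eq: "\<And>z. z \<in> D \<Longrightarrow> z \<notin> E \<Longrightarrow> f z = g z" and "z \<in> D"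
  shows "f z = g z"
proof (rule tendsto_unique)
  have "eventually (\<lambda>\<zeta>. \<zeta> \<in> D - (E - {z})) (nhds z)"
    using assms by (intro eventually_nhds_in_open open_Diff finite_imp_closed) auto
  then have ev: "eventually (\<lambda>\<zeta>. f \<zeta> = g \<zeta>) (at z)"
    unfolding eventually_at_filter by (rule eventually_mono) (use eq in auto)
  show "g \<midarrow>z\<rightarrow> g z"
    using assms by (simp add: continuous_on_eq_continuous_at isContD)
  have "f \<midarrow>z\<rightarrow> f z"
    using assms by (simp add: continuous_on_eq_continuous_at isContD)
  then show "g \<midarrow>z\<rightarrow> f z"
    using ev by (rule Lim_transform_eventually)
qed simp


section \<open>Products of distinct linear factors and cubic curves\<close>

text \<open>
  The independence hypothesis says that the points \<open>(c i : d i)\<close> of the projective line are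
  distinct.  This form covers both \<open>\<Prod>(x - t i)\<close> and the reversed product \<open>\<Prod>(1 - t i w)\<close>, whose
  degree drops when some \<open>t i\<close> is zero.
\<close>

lemma simple_roots_prod_linear:
  fixes c d :: "nat \<Rightarrow> complex"
  assumes "finite I"
    and indep: "\<And>i j. i \<in> I \<Longrightarrow> j \<in> I \<Longrightarrow> i \<noteq> j \<Longrightarrow> c i * d j \<noteq> c j * d i"
    and nz: "\<And>i. i \<in> I \<Longrightarrow> c i \<noteq> 0 \<or> d i \<noteq> 0"
    and root: "poly (\<Prod>i\<in>I. [:c i, d i:]) a = 0"
  shows "poly (pderiv (\<Prod>i\<in>I. [:c i, d i:])) a \<noteq> 0"
proof -
  obtain k where k: "k \<in> I" "c k + a * d k = 0"
    using root \<open>finite I\<close> by (auto simp: poly_prod)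
  define Q where "Q = (\<Prod>i\<in>I - {k}. [:c i, d i:])"
  have F: "(\<Prod>i\<in>I. [:c i, d i:]) = [:c k, d k:] * Q"
    unfolding Q_def using \<open>finite I\<close> k(1) by (rule prod.remove)
  have ck: "c k = - a * d k" using k(2) by (simp add: add_eq_0_iff2)
  have "d k \<noteq> 0" using nz[OF k(1)] ck by auto
  moreover have "poly Q a \<noteq> 0"
  proof
    assume "poly Q a = 0"
    then obtain i where i: "i \<in> I" "i \<noteq> k" "c i + a * d i = 0"
      using \<open>finite I\<close> by (auto simp: Q_def poly_prod)
    then have "c i = - a * d i" by (simp add: add_eq_0_iff2)
    then show False using indep[OF i(1) k(1) i(2)] ck by simp
  qed
  ultimately show ?thesis
    using k(2) unfolding F pderiv_mult poly_add poly_mult by (simp add: pderiv_pCons)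
qed

text \<open>
  On the smooth curve \<open>b^3 = F(a)\<close> the form \<open>da / b^2\<close> is holomorphic: differentiating the equation
  gives \<open>da / b^2 = 3 db / F'(a)\<close>, and \<open>b\<close> and \<open>F'(a)\<close> have no common zero.
\<close>

lemma immersed_cubic_form:
  assumes "open D" "immersion D a b"
    and eq: "\<And>z. z \<in> D \<Longrightarrow> b z ^ 3 = poly F (a z)"
    and simple: "\<And>x. poly F x = 0 \<Longrightarrow> poly (pderiv F) x \<noteq> 0"
  obtains \<phi> where "\<phi> holomorphic_on D" "\<And>z. z \<in> D \<Longrightarrow> \<phi> z * b z ^ 2 = deriv a z"
proof -
  have a: "a holomorphic_on D" and b: "b holomorphic_on D"
    using assms(2) by (auto simp: immersion_def)
  have diff: "3 * b z ^ 2 * deriv b z = poly (pderiv F) (a z) * deriv a z" if "z \<in> D" for z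
  proof -
    have da: "(a has_field_derivative deriv a z) (at z)"
      and db: "(b has_field_derivative deriv b z) (at z)"
      using holomorphic_derivI[OF a \<open>open D\<close> that] holomorphic_derivI[OF b \<open>open D\<close> that] .
    have "((\<lambda>\<zeta>. b \<zeta> ^ 3) has_field_derivative 3 * b z ^ 2 * deriv b z) (at z)"
      using DERIV_power[OF db, of 3] by (simp add: mult_ac)
    moreover have "((\<lambda>\<zeta>. b \<zeta> ^ 3) has_field_derivative poly (pderiv F) (a z) * deriv a z) (at z)"
      by (rule has_field_derivative_transform_within_open[OF DERIV_chain2[OF poly_DERIV da]
            \<open>open D\<close> that]) (simp add: eq)
    ultimately show ?thesis by (rule DERIV_unique)
  qed
  define D1 where "D1 = {z\<in>D. b z \<noteq> 0}"
  define D2 where "D2 = {z\<in>D. poly (pderiv F) (a z) \<noteq> 0}"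
  define \<phi> where
    "\<phi> z = (if b z \<noteq> 0 then deriv a z / b z ^ 2 else 3 * deriv b z / poly (pderiv F) (a z))" for z
  have opn: "open {z\<in>D. f z \<noteq> 0}" if "f holomorphic_on D" for f :: "complex \<Rightarrow> complex"
  proof -
    have "{z\<in>D. f z \<noteq> 0} = D \<inter> f -` (- {0})" by auto
    then show ?thesis
      using continuous_open_preimage[OF holomorphic_on_imp_continuous_on[OF that] \<open>open D\<close>]
      by (metis open_Compl closed_singleton)
  qed
  have Fa: "(\<lambda>z. poly (pderiv F) (a z)) holomorphic_on D"
    using a by (intro holomorphic_intros)
  have "open D1" "open D2"
    unfolding D1_def D2_def using opn[OF b] opn[OF Fa] .
  have D12: "D = D1 \<union> D2"
    using eq simple by (fastforce simp: D1_def D2_def)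
  have "D1 \<subseteq> D" "D2 \<subseteq> D" by (auto simp: D1_def D2_def)
  have da: "deriv a holomorphic_on D" and db: "deriv b holomorphic_on D"
    using a b \<open>open D\<close> by (auto intro: holomorphic_deriv)
  have "\<phi> holomorphic_on D1"
  proof (rule holomorphic_transform)
    show "(\<lambda>z. deriv a z / b z ^ 2) holomorphic_on D1"
      using holomorphic_on_subset[OF da \<open>D1 \<subseteq> D\<close>] holomorphic_on_subset[OF b \<open>D1 \<subseteq> D\<close>]
      by (intro holomorphic_on_divide holomorphic_on_power) (simp_all add: D1_def)
  qed (auto simp: D1_def \<phi>_def)
  moreover have "\<phi> holomorphic_on D2"
  proof (rule holomorphic_transform)
    show "(\<lambda>z. 3 * deriv b z / poly (pderiv F) (a z)) holomorphic_on D2"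
      using holomorphic_on_subset[OF db \<open>D2 \<subseteq> D\<close>] holomorphic_on_subset[OF Fa \<open>D2 \<subseteq> D\<close>]
      by (intro holomorphic_on_divide holomorphic_on_mult holomorphic_on_const) (simp_all add: D2_def)
  next
    fix z assume "z \<in> D2"
    then show "3 * deriv b z / poly (pderiv F) (a z) = \<phi> z"
      using diff[of z] by (auto simp: D2_def \<phi>_def divide_simps mult_ac)
  qed
  ultimately have "\<phi> holomorphic_on D"
    unfolding D12 using \<open>open D1\<close> \<open>open D2\<close> by (intro holomorphic_on_Un)
  moreover have "\<phi> z * b z ^ 2 = deriv a z" if "z \<in> D" for z
  proof (cases "b z = 0")
    case True
    then have "poly (pderiv F) (a z) \<noteq> 0" using eq[OF that] simple by auto
    then show ?thesis using diff[OF that] True by simp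
  qed (simp add: \<phi>_def)
  ultimately show thesis by (rule that)
qed


section \<open>Local coordinates on the triple cover\<close>

locale triple_cover =
  fixes t :: "nat \<Rightarrow> complex" and r :: nat
  assumes inj_t: "inj_on t {1..r}" and t_1: "t 1 = 0" and r_div: "3 dvd r" and r_ge: "r \<ge> 6"
begin

definition m :: nat where "m = r div 3"

lemma r_eq: "3 * m = r" and m_ge: "m \<ge> 2"
  using r_div r_ge by (auto simp: m_def)

definition P :: "complex poly" where "P = (\<Prod>i\<in>{1..r}. [:- t i, 1:])"

text \<open>The affine piece at infinity is \<open>v^3 = R(w)\<close>.\<close>

definition R :: "complex poly" where "R = (\<Prod>i\<in>{1..r}. [:1, - t i:])"

lemma poly_P: "poly P x = (\<Prod>i=1..r. x - t i)"
  by (simp add: P_def poly_prod)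

lemma poly_P_0: "poly P 0 = 0"
proof -
  have "1 \<in> {1..r}" using r_ge by auto
  then show ?thesis using t_1 by (force simp: poly_P)
qed

lemma degree_P: "degree P = r"
  unfolding P_def by (subst degree_prod_eq_sum_degree) auto

lemma simple_roots_P: "poly P x = 0 \<Longrightarrow> poly (pderiv P) x \<noteq> 0"
  unfolding P_def
  by (rule simple_roots_prod_linear[where c = "\<lambda>i. - t i" and d = "\<lambda>i. 1"])
    (use inj_onD[OF inj_t] in force)+

lemma simple_roots_R: "poly R x = 0 \<Longrightarrow> poly (pderiv R) x \<noteq> 0"
  unfolding R_def
  by (rule simple_roots_prod_linear[where c = "\<lambda>i. 1" and d = "\<lambda>i. - t i"])
    (use inj_onD[OF inj_t] in force)+

lemma poly_P_eq_R: "x \<noteq> 0 \<Longrightarrow> poly P x = x ^ r * poly R (1 / x)"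
proof -
  assume "x \<noteq> 0"
  have "poly P x = (\<Prod>i=1..r. x * (1 - t i / x))"
    unfolding poly_P by (intro prod.cong) (use \<open>x \<noteq> 0\<close> in \<open>auto simp: field_simps\<close>)
  also have "\<dots> = x ^ r * poly R (1 / x)"
    by (simp add: prod.distrib R_def poly_prod)
  finally show ?thesis .
qed

text \<open>
  At a generic point \<open>x\<close> and \<open>y\<close> have neither zeros nor poles, so \<open>x\<close>, \<open>y\<close>, \<open>1 / u\<close> are
  holomorphic functions of any local coordinate there, and no case distinction between the two affine
  pieces is necessary.
\<close>

definition generic :: "point \<Rightarrow> bool" where
  "generic p \<longleftrightarrow> p \<notin> range At_Inf \<and> coord_x p \<noteq> 0 \<and> coord_y p \<noteq> 0"

lemma genericE:
  assumes "generic p" obtains x y where "p = Affine x y" "x \<noteq> 0" "y \<noteq> 0"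
proof (cases p)
  case (Affine x y)
  with assms show thesis by (intro that[of x y]) (simp_all add: generic_def)
qed (use assms in \<open>simp add: generic_def\<close>)

lemma finite_nongeneric: "finite {p \<in> curve t r. \<not> generic p}"
proof (rule finite_subset)
  have "P \<noteq> 0" using degree_P r_ge by auto
  show "{p \<in> curve t r. \<not> generic p} \<subseteq>
      {Affine 0 0} \<union> (\<lambda>x. Affine x 0) ` {x. poly P x = 0} \<union> At_Inf ` {v. v ^ 3 = 1}"
  proof
    fix p assume "p \<in> {p \<in> curve t r. \<not> generic p}"
    then consider x y where "p = Affine x y" "y ^ 3 = poly P x" "x = 0 \<or> y = 0"
      | v where "p = At_Inf v" "v ^ 3 = 1"
      by (auto simp: curve_def generic_def poly_P)
    then show "p \<in> {Affine 0 0} \<union> (\<lambda>x. Affine x 0) ` {x. poly P x = 0} \<union> At_Inf ` {v. v ^ 3 = 1}"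
      by cases (use poly_P_0 in auto)
  qed
  have "finite {v :: complex. v ^ 3 = 1}" by (rule finite_roots_unity) simp
  then show "finite ({Affine 0 0} \<union> (\<lambda>x. Affine x 0) ` {x. poly P x = 0} \<union> At_Inf ` {v. v ^ 3 = 1})"
    using poly_roots_finite[OF \<open>P \<noteq> 0\<close>] by simp
qed

lemma generic_equation: "p \<in> curve t r \<Longrightarrow> generic p \<Longrightarrow> coord_y p ^ 3 = poly P (coord_x p)"
  by (auto simp: curve_def generic_def poly_P)

lemma coord_w_generic: "generic p \<Longrightarrow> coord_w p = 1 / coord_x p"
  by (auto elim!: genericE)

lemma coord_v_generic: "generic p \<Longrightarrow> coord_y p = coord_v r p * coord_x p ^ m"
  by (auto elim!: genericE simp: m_def)

text \<open>
  A patch may lie in both affine pieces, but its local coordinate is an immersion into at least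
  one of them; only this piece is used, together with the shape of \<open>u\<close> that belongs to it.
\<close>

lemma trivialisation_cases [consumes 1, case_names affine at_inf]:
  assumes "trivialisation t r (D, \<psi>, u)"
  obtains g where "\<psi> ` D \<subseteq> piece_xy t r" "immersion D (coord_x \<circ> \<psi>) (coord_y \<circ> \<psi>)"
      "g holomorphic_on D" "\<And>z. z \<in> D \<Longrightarrow> g z \<noteq> 0" "\<And>z. z \<in> D \<Longrightarrow> u z = g z * coord_x (\<psi> z)"
  | "\<psi> ` D \<subseteq> piece_wv t r" "immersion D (coord_w \<circ> \<psi>) (coord_v r \<circ> \<psi>)"
      "\<And>z. z \<in> D \<Longrightarrow> u z \<noteq> 0"
proof -
  from assms consider "\<psi> ` D \<subseteq> piece_xy t r" "immersion D (coord_x \<circ> \<psi>) (coord_y \<circ> \<psi>)"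
    | "\<psi> ` D \<subseteq> piece_wv t r" "immersion D (coord_w \<circ> \<psi>) (coord_v r \<circ> \<psi>)"
    unfolding trivialisation_def local_coordinate_def by blast
  then show thesis
  proof cases
    case 1
    then obtain g where "g holomorphic_on D" "\<forall>z\<in>D. g z \<noteq> 0 \<and> u z = g z * coord_x (\<psi> z)"
      using assms unfolding trivialisation_def generates_ideal_F_def by blast
    with 1 show thesis using that(1)[of g] by blast
  next
    case 2
    then have "\<forall>z\<in>D. u z \<noteq> 0"
      using assms unfolding trivialisation_def generates_ideal_F_def by blast
    with 2 show thesis using that(2) by blast
  qed
qed

context
  fixes D \<psi> u
  assumes triv: "trivialisation t r (D, \<psi>, u)"
begin

lemma triv_open: "open D" and triv_inj: "inj_on \<psi> D" and triv_u: "u holomorphic_on D"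
  and triv_curve: "z \<in> D \<Longrightarrow> \<psi> z \<in> curve t r"
  using triv by (auto simp: trivialisation_def local_coordinate_def generates_ideal_F_def
      piece_xy_def piece_wv_def)

lemma finite_exceptional: "finite {z\<in>D. \<not> generic (\<psi> z)}"
proof (rule finite_imageD)
  show "finite (\<psi> ` {z\<in>D. \<not> generic (\<psi> z)})"
    by (rule finite_subset[OF _ finite_nongeneric]) (use triv_curve in auto)
  show "inj_on \<psi> {z\<in>D. \<not> generic (\<psi> z)}"
    by (rule inj_on_subset[OF triv_inj]) auto
qed

lemma open_generic_part: "open {z\<in>D. generic (\<psi> z)}"
proof -
  have "{z\<in>D. generic (\<psi> z)} = D - {z\<in>D. \<not> generic (\<psi> z)}" by auto
  then show ?thesis
    using triv_open finite_exceptional by (metis open_Diff finite_imp_closed)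
qed

lemma eq_from_generic:
  assumes "f holomorphic_on D" "g holomorphic_on D"
    and "\<And>z. z \<in> D \<Longrightarrow> generic (\<psi> z) \<Longrightarrow> f z = g z" and "z \<in> D"
  shows "f z = g z"
  by (rule continuous_eq_off_finite[OF triv_open finite_exceptional])
    (use assms in \<open>auto intro: holomorphic_on_imp_continuous_on\<close>)

lemma u_nonzero: "z \<in> D \<Longrightarrow> generic (\<psi> z) \<Longrightarrow> u z \<noteq> 0"
  using triv by (cases rule: trivialisation_cases) (auto simp: generic_def)

lemma coord_x_holomorphic: "(coord_x \<circ> \<psi>) holomorphic_on {z\<in>D. generic (\<psi> z)}"
  using triv
proof (cases rule: trivialisation_cases)
  case affine
  then show ?thesis unfolding immersion_def by (auto intro: holomorphic_on_subset)
next
  case at_inf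
  have w: "(coord_w \<circ> \<psi>) holomorphic_on {z\<in>D. generic (\<psi> z)}"
    using at_inf(2) unfolding immersion_def by (auto intro: holomorphic_on_subset)
  have "(\<lambda>z. 1 / (coord_w \<circ> \<psi>) z) holomorphic_on {z\<in>D. generic (\<psi> z)}"
    by (intro holomorphic_on_divide holomorphic_on_const w) (auto simp: coord_w_generic generic_def)
  then show ?thesis
    by (rule holomorphic_transform) (auto simp: coord_w_generic)
qed

lemma coord_y_holomorphic: "(coord_y \<circ> \<psi>) holomorphic_on {z\<in>D. generic (\<psi> z)}"
  using triv
proof (cases rule: trivialisation_cases)
  case affine
  then show ?thesis unfolding immersion_def by (auto intro: holomorphic_on_subset)
next
  case at_inf
  have v: "(coord_v r \<circ> \<psi>) holomorphic_on {z\<in>D. generic (\<psi> z)}"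
    using at_inf(2) unfolding immersion_def by (auto intro: holomorphic_on_subset)
  have "(\<lambda>z. (coord_v r \<circ> \<psi>) z * (coord_x \<circ> \<psi>) z ^ m) holomorphic_on {z\<in>D. generic (\<psi> z)}"
    by (intro holomorphic_on_mult holomorphic_on_power coord_x_holomorphic v)
  then show ?thesis
    by (rule holomorphic_transform) (auto simp: coord_v_generic)
qed

section \<open>Holomorphy of the forms \<open>\<alpha> i\<close> and \<open>\<beta> j\<close>\<close>

text \<open>
  The cases \<open>e = 1\<close> and \<open>e = 2\<close> are those of the \<open>\<alpha> i\<close> and the \<open>\<beta> j\<close>.  At finite distance the form
  \<open>x^i dx / y^e\<close> is \<open>x^i y^(2-e)\<close> times the holomorphic form \<open>dx / y^2\<close>, and \<open>i \<ge> 1\<close> makes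
  it vanish on \<open>F\<close>.  At infinity it is \<open>- w^(e m - 2 - i) v^(2-e)\<close> times the holomorphic form
  \<open>dw / v^2\<close>, and the bound on \<open>i\<close> makes the exponent of \<open>w\<close> nonnegative.
\<close>

lemma form_extends:
  assumes "e \<le> 2" "1 \<le> i" "i + 2 \<le> e * m"
  obtains f where "f holomorphic_on D"
    and "\<And>z. z \<in> D \<Longrightarrow> generic (\<psi> z) \<Longrightarrow>
      f z * u z * coord_y (\<psi> z) ^ e = coord_x (\<psi> z) ^ i * deriv (coord_x \<circ> \<psi>) z"
  using triv
proof (cases rule: trivialisation_cases)
  case (affine g)
  have eq: "(coord_y \<circ> \<psi>) z ^ 3 = poly P ((coord_x \<circ> \<psi>) z)" if "z \<in> D" for z
    using affine(1) that by (force simp: piece_xy_def curve_def poly_P)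
  obtain \<phi> where \<phi>: "\<phi> holomorphic_on D"
      "\<And>z. z \<in> D \<Longrightarrow> \<phi> z * (coord_y \<circ> \<psi>) z ^ 2 = deriv (coord_x \<circ> \<psi>) z"
    using immersed_cubic_form[OF triv_open affine(2) eq simple_roots_P] by blast
  show thesis
  proof (rule that)
    show "(\<lambda>z. (coord_x \<circ> \<psi>) z ^ (i - 1) * (coord_y \<circ> \<psi>) z ^ (2 - e) * \<phi> z / g z)
        holomorphic_on D"
      using affine(2)[unfolded immersion_def]
      by (intro holomorphic_on_divide holomorphic_on_mult holomorphic_on_power \<phi>(1) affine(3,4)) blast+
    fix z assume z: "z \<in> D" "generic (\<psi> z)"
    define x y where "x = coord_x (\<psi> z)" and "y = coord_y (\<psi> z)"
    have "x ^ (i - 1) * y ^ (2 - e) * \<phi> z / g z * (g z * x) * y ^ e =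
        (x ^ (i - 1) * x) * (\<phi> z * (y ^ (2 - e) * y ^ e))"
      using affine(4)[OF z(1)] by simp
    also have "x ^ (i - 1) * x = x ^ i"
      using \<open>1 \<le> i\<close> by (metis power_minus_mult less_le_trans zero_less_one)
    also have "y ^ (2 - e) * y ^ e = y ^ 2"
      using \<open>e \<le> 2\<close> by (simp flip: power_add)
    finally show "(coord_x \<circ> \<psi>) z ^ (i - 1) * (coord_y \<circ> \<psi>) z ^ (2 - e) * \<phi> z / g z * u z *
        coord_y (\<psi> z) ^ e = coord_x (\<psi> z) ^ i * deriv (coord_x \<circ> \<psi>) z"
      using \<phi>(2)[OF z(1)] affine(5)[OF z(1)] by (simp add: x_def y_def)
  qed
next
  case at_inf
  have eq: "(coord_v r \<circ> \<psi>) z ^ 3 = poly R ((coord_w \<circ> \<psi>) z)" if "z \<in> D" for z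
  proof (cases "\<psi> z")
    case (Affine x y)
    then have "x \<noteq> 0" "y ^ 3 = poly P x"
      using at_inf(1) that by (force simp: piece_wv_def curve_def poly_P)+
    moreover have "(x ^ m) ^ 3 = x ^ r"
      using r_eq by (simp add: mult.commute flip: power_mult)
    ultimately show ?thesis
      using Affine by (simp add: poly_P_eq_R power_divide flip: m_def)
  next
    case (At_Inf v)
    then have "v ^ 3 = 1"
      using at_inf(1) that by (force simp: piece_wv_def curve_def)
    then show ?thesis using At_Inf by (simp add: R_def poly_prod)
  qed
  obtain \<phi> where \<phi>: "\<phi> holomorphic_on D"
      "\<And>z. z \<in> D \<Longrightarrow> \<phi> z * (coord_v r \<circ> \<psi>) z ^ 2 = deriv (coord_w \<circ> \<psi>) z"
    using immersed_cubic_form[OF triv_open at_inf(2) eq simple_roots_R] by blast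
  show thesis
  proof (rule that)
    show "(\<lambda>z. - ((coord_w \<circ> \<psi>) z ^ (e * m - (i + 2)) * (coord_v r \<circ> \<psi>) z ^ (2 - e) * \<phi> z / u z))
        holomorphic_on D"
      using at_inf(2)[unfolded immersion_def]
      by (intro holomorphic_on_minus holomorphic_on_divide holomorphic_on_mult holomorphic_on_power
          \<phi>(1) triv_u at_inf(3)) blast+
    fix z assume z: "z \<in> D" "generic (\<psi> z)"
    define x v where "x = coord_x (\<psi> z)" and "v = coord_v r (\<psi> z)"
    have x: "x \<noteq> 0" and w: "coord_w (\<psi> z) = 1 / x"
      using z by (auto simp: x_def generic_def coord_w_generic)
    have y: "coord_y (\<psi> z) = v * x ^ m"
      using z by (simp add: x_def v_def coord_v_generic)
    have dw: "((coord_w \<circ> \<psi>) has_field_derivative deriv (coord_w \<circ> \<psi>) z) (at z)"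
      using at_inf(2) triv_open z(1) unfolding immersion_def by (blast intro: holomorphic_derivI)
    have "((\<lambda>z. inverse ((coord_w \<circ> \<psi>) z)) has_field_derivative
        - (deriv (coord_w \<circ> \<psi>) z * x ^ 2)) (at z)"
      using DERIV_inverse_fun[OF dw] x w by (simp add: power2_eq_square field_simps)
    then have "((coord_x \<circ> \<psi>) has_field_derivative - (deriv (coord_w \<circ> \<psi>) z * x ^ 2)) (at z)"
      by (rule has_field_derivative_transform_within_open[OF _ open_generic_part])
        (use z in \<open>auto simp: coord_w_generic\<close>)
    then have dx: "deriv (coord_x \<circ> \<psi>) z = - (deriv (coord_w \<circ> \<psi>) z * x ^ 2)"
      by (rule DERIV_imp_deriv)
    have "- ((1 / x) ^ (e * m - (i + 2)) * v ^ (2 - e) * \<phi> z / u z) * u z * (v * x ^ m) ^ e =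
        - (((1 / x) ^ (e * m - (i + 2)) * x ^ (e * m)) * (\<phi> z * (v ^ (2 - e) * v ^ e)))"
      using at_inf(3)[OF z(1)] by (simp add: power_mult_distrib mult.commute flip: power_mult)
    also have "v ^ (2 - e) * v ^ e = v ^ 2"
      using \<open>e \<le> 2\<close> by (simp flip: power_add)
    also have "x ^ (e * m) = x ^ (e * m - (i + 2)) * x ^ (i + 2)"
      by (simp only: power_add[symmetric] le_add_diff_inverse2[OF assms(3)])
    also have "(1 / x) ^ (e * m - (i + 2)) * (x ^ (e * m - (i + 2)) * x ^ (i + 2)) = x ^ i * x ^ 2"
      using x by (simp add: power_divide power_add power2_eq_square)
    finally show "- ((coord_w \<circ> \<psi>) z ^ (e * m - (i + 2)) * (coord_v r \<circ> \<psi>) z ^ (2 - e) * \<phi> z / u z) *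
        u z * coord_y (\<psi> z) ^ e = coord_x (\<psi> z) ^ i * deriv (coord_x \<circ> \<psi>) z"
      using \<phi>(2)[OF z(1)] by (simp add: dx w y flip: x_def v_def)
  qed
qed

text \<open>
  Removing the singularities of the quotient that defines the form yields any holomorphic function
  that agrees with the quotient at generic points, since these fill a punctured neighbourhood of
  every point.
\<close>

lemma form_dx_eq:
  assumes f: "f holomorphic_on D"
    and eq: "\<And>z. z \<in> D \<Longrightarrow> generic (\<psi> z) \<Longrightarrow>
      f z * u z * coord_y (\<psi> z) ^ e = coord_x (\<psi> z) ^ i * deriv (coord_x \<circ> \<psi>) z"
    and "z \<in> D"
  shows "form_dx t r (\<lambda>x y. x ^ i / y ^ e) ((D, \<psi>, u), z) = f z"
proof -
  let ?F = "\<lambda>\<zeta>. coord_x (\<psi> \<zeta>) ^ i / coord_y (\<psi> \<zeta>) ^ e * deriv (coord_x \<circ> \<psi>) \<zeta> / u \<zeta>"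
  have "eventually (\<lambda>\<zeta>. \<zeta> \<in> D - ({z\<in>D. \<not> generic (\<psi> z)} - {z})) (nhds z)"
    using triv_open finite_exceptional \<open>z \<in> D\<close>
    by (intro eventually_nhds_in_open open_Diff finite_imp_closed finite_Diff) auto
  then have "eventually (\<lambda>\<zeta>. f \<zeta> = ?F \<zeta>) (at z)"
    unfolding eventually_at_filter
  proof (rule eventually_mono, intro impI)
    fix \<zeta> assume "\<zeta> \<in> D - ({z\<in>D. \<not> generic (\<psi> z)} - {z})" "\<zeta> \<noteq> z"
    then have \<zeta>: "\<zeta> \<in> D" "generic (\<psi> \<zeta>)" by auto
    then have "coord_y (\<psi> \<zeta>) \<noteq> 0" "u \<zeta> \<noteq> 0"
      using u_nonzero by (auto simp: generic_def)
    then show "f \<zeta> = ?F \<zeta>"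
      using eq[OF \<zeta>] by (simp add: field_simps)
  qed
  moreover have "f \<midarrow>z\<rightarrow> f z"
    using f triv_open \<open>z \<in> D\<close> holomorphic_on_imp_continuous_on continuous_on_eq_continuous_at isContD
    by blast
  ultimately have "?F \<midarrow>z\<rightarrow> f z"
    by (rule Lim_transform_eventually[rotated])
  then have "remove_sings ?F z = f z"
    by (rule remove_sings_eqI)
  then show ?thesis
    using triv \<open>z \<in> D\<close> by (simp add: form_dx_def patches_def)
qed

lemma
  assumes "e \<le> 2" "1 \<le> i" "i + 2 \<le> e * m"
  shows form_dx_holomorphic: "(\<lambda>z. form_dx t r (\<lambda>x y. x ^ i / y ^ e) ((D, \<psi>, u), z)) holomorphic_on D"
    and form_dx_generic: "z \<in> D \<Longrightarrow> generic (\<psi> z) \<Longrightarrow>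
      form_dx t r (\<lambda>x y. x ^ i / y ^ e) ((D, \<psi>, u), z) * u z * coord_y (\<psi> z) ^ e =
      coord_x (\<psi> z) ^ i * deriv (coord_x \<circ> \<psi>) z"
proof -
  obtain f where f: "f holomorphic_on D"
    "\<And>z. z \<in> D \<Longrightarrow> generic (\<psi> z) \<Longrightarrow>
      f z * u z * coord_y (\<psi> z) ^ e = coord_x (\<psi> z) ^ i * deriv (coord_x \<circ> \<psi>) z"
    using form_extends[OF assms] by metis
  note eq = form_dx_eq[OF f]
  show "(\<lambda>z. form_dx t r (\<lambda>x y. x ^ i / y ^ e) ((D, \<psi>, u), z)) holomorphic_on D"
    by (rule holomorphic_transform[OF f(1)]) (simp add: eq)
  show "form_dx t r (\<lambda>x y. x ^ i / y ^ e) ((D, \<psi>, u), z) * u z * coord_y (\<psi> z) ^ e =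
      coord_x (\<psi> z) ^ i * deriv (coord_x \<circ> \<psi>) z" if "z \<in> D" "generic (\<psi> z)"
    using f(2) that by (simp add: eq)
qed

end

text \<open>
  The transition law is the chain rule for \<open>x\<close> at generic points and follows at the others by
  continuity.
\<close>

lemma form_dx_section:
  assumes "e \<le> 2" "1 \<le> i" "i + 2 \<le> e * m"
  shows "form_dx t r (\<lambda>x y. x ^ i / y ^ e) \<in> H0_M t r" (is "?\<omega> \<in> _")
proof -
  have trans: "?\<omega> ((D, \<psi>, u), z) * u z ^ 1 = ?\<omega> ((D', \<psi>', u'), h z) * u' (h z) ^ 1 * deriv h z ^ (1 + 0)"
    if \<tau>: "trivialisation t r (D, \<psi>, u)" and \<tau>': "trivialisation t r (D', \<psi>', u')"
      and N: "open N" "N \<subseteq> D" and h: "h holomorphic_on N" "h ` N \<subseteq> D'"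
      and gl: "\<forall>z\<in>N. \<psi>' (h z) = \<psi> z" and z: "z \<in> N"
    for D \<psi> u D' \<psi>' u' N h z
  proof (rule continuous_eq_off_finite[OF N(1) finite_exceptional[OF \<tau>] _ _ _ z])
    have "(\<lambda>z. ?\<omega> ((D, \<psi>, u), z) * u z ^ 1) holomorphic_on N"
      using form_dx_holomorphic[OF \<tau> assms] triv_u[OF \<tau>] N(2)
      by (auto intro!: holomorphic_on_mult intro: holomorphic_on_subset)
    then show "continuous_on N (\<lambda>z. ?\<omega> ((D, \<psi>, u), z) * u z ^ 1)"
      by (rule holomorphic_on_imp_continuous_on)
    have "((\<lambda>z. ?\<omega> ((D', \<psi>', u'), z)) \<circ> h) holomorphic_on N" "(u' \<circ> h) holomorphic_on N"
      using form_dx_holomorphic[OF \<tau>' assms] triv_u[OF \<tau>'] h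
      by (auto intro: holomorphic_on_compose_gen)
    then have "(\<lambda>z. ?\<omega> ((D', \<psi>', u'), h z) * u' (h z) ^ 1 * deriv h z ^ (1 + 0)) holomorphic_on N"
      using holomorphic_deriv[OF h(1) N(1)] by (auto simp: o_def intro!: holomorphic_on_mult)
    then show "continuous_on N (\<lambda>z. ?\<omega> ((D', \<psi>', u'), h z) * u' (h z) ^ 1 * deriv h z ^ (1 + 0))"
      by (rule holomorphic_on_imp_continuous_on)
    fix \<zeta> assume \<zeta>: "\<zeta> \<in> N" "\<zeta> \<notin> {z \<in> D. \<not> generic (\<psi> z)}"
    then have D: "\<zeta> \<in> D" "generic (\<psi> \<zeta>)" and D': "h \<zeta> \<in> D'" "generic (\<psi>' (h \<zeta>))"
      using N h gl by auto
    have "((coord_x \<circ> \<psi>') has_field_derivative deriv (coord_x \<circ> \<psi>') (h \<zeta>)) (at (h \<zeta>))"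
      using holomorphic_derivI[OF coord_x_holomorphic[OF \<tau>'] open_generic_part[OF \<tau>']] D' by blast
    then have "((\<lambda>z. (coord_x \<circ> \<psi>') (h z)) has_field_derivative
        deriv (coord_x \<circ> \<psi>') (h \<zeta>) * deriv h \<zeta>) (at \<zeta>)"
      using holomorphic_derivI[OF h(1) N(1) \<zeta>(1)] by (rule DERIV_chain2)
    then have "((coord_x \<circ> \<psi>) has_field_derivative deriv (coord_x \<circ> \<psi>') (h \<zeta>) * deriv h \<zeta>) (at \<zeta>)"
      by (rule has_field_derivative_transform_within_open[OF _ N(1) \<zeta>(1)]) (simp add: gl)
    then have dx: "deriv (coord_x \<circ> \<psi>) \<zeta> = deriv (coord_x \<circ> \<psi>') (h \<zeta>) * deriv h \<zeta>"
      by (rule DERIV_imp_deriv)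
    have "?\<omega> ((D, \<psi>, u), \<zeta>) * u \<zeta> * coord_y (\<psi> \<zeta>) ^ e =
        ?\<omega> ((D', \<psi>', u'), h \<zeta>) * u' (h \<zeta>) * deriv h \<zeta> * coord_y (\<psi> \<zeta>) ^ e"
      using form_dx_generic[OF \<tau> assms D] form_dx_generic[OF \<tau>' assms D'] gl \<zeta>(1) dx
      by (simp add: mult_ac)
    then show "?\<omega> ((D, \<psi>, u), \<zeta>) * u \<zeta> ^ 1 =
        ?\<omega> ((D', \<psi>', u'), h \<zeta>) * u' (h \<zeta>) ^ 1 * deriv h \<zeta> ^ (1 + 0)"
      using D(2) by (simp add: generic_def)
  qed
  have "(\<lambda>z. ?\<omega> (\<tau>, z)) holomorphic_on fst \<tau>" if "trivialisation t r \<tau>" for \<tau>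
  proof -
    obtain D \<psi> u where \<tau>: "\<tau> = (D, \<psi>, u)" by (cases \<tau>) auto
    then show ?thesis using form_dx_holomorphic[OF _ assms] that by simp
  qed
  moreover have "?\<omega> q = 0" if "q \<notin> patches t r" for q
    using that by (auto simp: form_dx_def split: prod.splits)
  ultimately show ?thesis
    unfolding sections_def mem_Collect_eq
    by (intro conjI allI impI ballI) (blast, blast, elim conjE, rule trans)
qed


section \<open>The Gaussian map in terms of polynomials in \<open>x\<close>\<close>

text \<open>
  The section is \<open>p(x) / P(x)^2 (dx)^3\<close>, a form of weight \<open>3\<close> because \<open>M^2 \<otimes> K\<close> is contained in
  \<open>K^3\<close>; the factor \<open>u^2\<close> passes from the frame \<open>(u dz)^2 \<otimes> dz\<close> to \<open>dz^3\<close>.  This relation is linear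
  and injective in both directions, so it transports dimensions from polynomials to sections
  without choosing a section for every polynomial, not all of which have one.
\<close>

definition represents :: "complex poly \<Rightarrow> bundle_section \<Rightarrow> bool" where
  "represents p \<sigma> \<longleftrightarrow> (\<forall>q. q \<notin> patches t r \<longrightarrow> \<sigma> q = 0) \<and>
     (\<forall>D \<psi> u. trivialisation t r (D, \<psi>, u) \<longrightarrow> (\<lambda>z. \<sigma> ((D, \<psi>, u), z)) holomorphic_on D \<and>
       (\<forall>z\<in>D. generic (\<psi> z) \<longrightarrow> \<sigma> ((D, \<psi>, u), z) * u z ^ 2 * poly P (coord_x (\<psi> z)) ^ 2 =
          poly p (coord_x (\<psi> z)) * deriv (coord_x \<circ> \<psi>) z ^ 3))"

lemma represents_outside: "represents p \<sigma> \<Longrightarrow> q \<notin> patches t r \<Longrightarrow> \<sigma> q = 0"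
  unfolding represents_def by blast

lemma representsD:
  assumes "represents p \<sigma>" "trivialisation t r (D, \<psi>, u)"
  shows "(\<lambda>z. \<sigma> ((D, \<psi>, u), z)) holomorphic_on D"
    and "z \<in> D \<Longrightarrow> generic (\<psi> z) \<Longrightarrow> \<sigma> ((D, \<psi>, u), z) * u z ^ 2 * poly P (coord_x (\<psi> z)) ^ 2 =
          poly p (coord_x (\<psi> z)) * deriv (coord_x \<circ> \<psi>) z ^ 3"
  using assms unfolding represents_def by blast+

lemma represents_0: "represents 0 0"
  by (simp add: represents_def)

lemma represents_add:
  assumes "represents p \<sigma>" "represents p' \<sigma>'"
  shows "represents (p + p') (\<sigma> + \<sigma>')"
  unfolding represents_def
proof (intro conjI allI impI ballI)
  show "(\<sigma> + \<sigma>') q = 0" if "q \<notin> patches t r" for q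
    using assms[THEN represents_outside] that by simp
  fix D \<psi> u assume \<tau>: "trivialisation t r (D, \<psi>, u)"
  note d = representsD[OF assms(1) \<tau>] representsD[OF assms(2) \<tau>]
  show "(\<lambda>z. (\<sigma> + \<sigma>') ((D, \<psi>, u), z)) holomorphic_on D"
    using d(1,3) by (simp add: holomorphic_on_add)
  fix z assume "z \<in> D" "generic (\<psi> z)"
  then show "(\<sigma> + \<sigma>') ((D, \<psi>, u), z) * u z ^ 2 * poly P (coord_x (\<psi> z)) ^ 2 =
      poly (p + p') (coord_x (\<psi> z)) * deriv (coord_x \<circ> \<psi>) z ^ 3"
    using d(2,4)[of z] by (simp add: distrib_right)
qed

lemma represents_scale:
  assumes "represents p \<sigma>"
  shows "represents (smult c p) (cscale c \<sigma>)"
  unfolding represents_def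
proof (intro conjI allI impI ballI)
  show "cscale c \<sigma> q = 0" if "q \<notin> patches t r" for q
    using assms[THEN represents_outside] that by simp
  fix D \<psi> u assume \<tau>: "trivialisation t r (D, \<psi>, u)"
  note d = representsD[OF assms \<tau>]
  show "(\<lambda>z. cscale c \<sigma> ((D, \<psi>, u), z)) holomorphic_on D"
    using d(1) by (simp add: holomorphic_on_mult)
  fix z assume "z \<in> D" "generic (\<psi> z)"
  then show "cscale c \<sigma> ((D, \<psi>, u), z) * u z ^ 2 * poly P (coord_x (\<psi> z)) ^ 2 =
      poly (smult c p) (coord_x (\<psi> z)) * deriv (coord_x \<circ> \<psi>) z ^ 3"
    using d(2)[of z] by (simp add: mult.assoc)
qed

lemma represents_diff:
  assumes "represents p \<sigma>" "represents p' \<sigma>'"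
  shows "represents (p - p') (\<sigma> - \<sigma>')"
proof -
  have "\<sigma> - \<sigma>' = \<sigma> + cscale (-1) \<sigma>'" by (simp add: fun_eq_iff)
  then show ?thesis
    using represents_add[OF assms(1) represents_scale[OF assms(2), of "-1"]] by simp
qed

lemma represents_sum:
  assumes "\<And>k. k \<in> K \<Longrightarrow> represents (p k) (\<sigma> k)"
  shows "represents (\<Sum>k\<in>K. smult (c k) (p k)) (\<Sum>k\<in>K. cscale (c k) (\<sigma> k))"
  using assms
  by (induction K rule: infinite_finite_induct)
    (simp_all add: represents_0 represents_add represents_scale)

lemma represents_zero_imp_section_zero:
  assumes "represents 0 \<sigma>" shows "\<sigma> = 0"
proof
  fix q :: "triv \<times> complex"
  obtain D \<psi> u z where q: "q = ((D, \<psi>, u), z)" by (metis prod.exhaust)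
  show "\<sigma> q = 0 q"
  proof (cases "q \<in> patches t r")
    case True
    then have \<tau>: "trivialisation t r (D, \<psi>, u)" and z: "z \<in> D" by (auto simp: q patches_def)
    have "\<sigma> ((D, \<psi>, u), z) = 0"
    proof (rule eq_from_generic[OF \<tau> representsD(1)[OF assms \<tau>] holomorphic_on_const _ z])
      fix \<zeta> assume \<zeta>: "\<zeta> \<in> D" "generic (\<psi> \<zeta>)"
      have "coord_y (\<psi> \<zeta>) \<noteq> 0" using \<zeta> by (simp add: generic_def)
      then have "poly P (coord_x (\<psi> \<zeta>)) \<noteq> 0"
        using generic_equation[OF triv_curve[OF \<tau> \<zeta>(1)] \<zeta>(2)] by (metis power_not_zero)
      then show "\<sigma> ((D, \<psi>, u), \<zeta>) = 0"
        using representsD(2)[OF assms \<tau> \<zeta>] u_nonzero[OF \<tau> \<zeta>] by simp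
    qed
    then show ?thesis by (simp add: q)
  qed (simp add: represents_outside[OF assms])
qed

lemma represents_unique: "represents p \<sigma> \<Longrightarrow> represents p \<sigma>' \<Longrightarrow> \<sigma> = \<sigma>'"
  using represents_zero_imp_section_zero[of "\<sigma> - \<sigma>'"] represents_diff[of p \<sigma> p \<sigma>'] by simp

text \<open>
  A polynomial with zero section vanishes at the \<open>x\<close>-values of all generic points where \<open>x\<close> is a
  local coordinate.  One patch with infinitely many of them suffices: the branch of \<open>y\<close> given by the principal cube root of \<open>P\<close>, over
  the open set where \<open>P\<close> avoids the cut of the logarithm.  There \<open>x\<close> itself is the coordinate.
\<close>

lemma represents_zero_imp_poly_zero:
  assumes "represents p 0" shows "p = 0"
proof (rule ccontr)
  assume "p \<noteq> 0"
  define D where "D = {x. poly P x \<notin> \<real>\<^sub>\<le>\<^sub>0}"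
  define y where "y x = exp (Ln (poly P x) / 3)" for x
  define \<psi> where "\<psi> x = Affine x (y x)" for x
  have y3: "y x ^ 3 = poly P x" if "x \<in> D" for x
  proof -
    have "poly P x \<noteq> 0" using that by (auto simp: D_def)
    then show ?thesis by (simp add: y_def flip: exp_of_nat_mult)
  qed
  have x_nz: "x \<noteq> 0" if "x \<in> D" for x
    using that poly_P_0 by (auto simp: D_def)
  have opn: "open D"
  proof -
    have "D = poly P -` (- \<real>\<^sub>\<le>\<^sub>0)" by (auto simp: D_def)
    moreover have "open (poly P -` (- \<real>\<^sub>\<le>\<^sub>0))"
      by (intro open_vimage open_Compl closed_nonpos_Reals_complex continuous_intros)
    ultimately show ?thesis by simp
  qed
  have y_hol: "y holomorphic_on D"
    unfolding y_def by (intro holomorphic_intros) (auto simp: D_def)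
  have xy: "coord_x \<circ> \<psi> = (\<lambda>x. x)" "coord_y \<circ> \<psi> = y"
    by (auto simp: \<psi>_def)
  have piece: "\<psi> ` D \<subseteq> piece_xy t r"
    using y3 by (auto simp: piece_xy_def curve_def \<psi>_def poly_P)
  have \<tau>: "trivialisation t r (D, \<psi>, \<lambda>_. 1)"
    unfolding trivialisation_def local_coordinate_def generates_ideal_F_def prod.case
  proof (intro conjI impI)
    show "inj_on \<psi> D" by (auto simp: \<psi>_def inj_on_def)
    have "immersion D (coord_x \<circ> \<psi>) (coord_y \<circ> \<psi>)"
      unfolding xy immersion_def using y_hol by simp
    then show "\<psi> ` D \<subseteq> piece_xy t r \<and> immersion D (coord_x \<circ> \<psi>) (coord_y \<circ> \<psi>) \<or>
        \<psi> ` D \<subseteq> piece_wv t r \<and> immersion D (coord_w \<circ> \<psi>) (coord_v r \<circ> \<psi>)"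
      using piece by blast
    \<comment> \<open>the set avoids \<open>x = 0\<close>, because \<open>P 0 = 0\<close> lies on the cut; so \<open>1 = (1 / x) x\<close> generates the ideal\<close>
    have "(\<lambda>x. 1 / x) holomorphic_on D"
      using x_nz by (intro holomorphic_intros) auto
    moreover have "\<forall>x\<in>D. 1 / x \<noteq> 0 \<and> 1 = 1 / x * coord_x (\<psi> x)"
      using x_nz by (simp add: \<psi>_def)
    ultimately show "\<exists>g. g holomorphic_on D \<and> (\<forall>z\<in>D. g z \<noteq> 0 \<and> 1 = g z * coord_x (\<psi> z))"
      by blast
  qed (use opn in auto)
  have "poly p x = 0" if "x \<in> D" for x
  proof -
    have "y x \<noteq> 0" by (simp add: y_def)
    then have "generic (\<psi> x)" using x_nz[OF that] by (auto simp: generic_def \<psi>_def)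
    from representsD(2)[OF assms \<tau> that this] show ?thesis
      by (simp add: xy) (simp add: \<psi>_def)
  qed
  then have "D \<subseteq> {x. poly p x = 0}" by blast
  then have "finite D" using poly_roots_finite[OF \<open>p \<noteq> 0\<close>] finite_subset by blast
  moreover have "D \<noteq> {}"
  proof -
    \<comment> \<open>\<open>P\<close> takes the value \<open>1\<close>, which is off the cut\<close>
    have "\<not> constant (poly P)"
      using degree_P r_ge by (simp add: constant_degree)
    then have "\<not> constant (poly (P - 1))"
      by (simp add: constant_def)
    then obtain x where "poly (P - 1) x = 0"
      using fundamental_theorem_of_algebra by blast
    then have "x \<in> D" by (simp add: D_def)
    then show ?thesis by blast
  qed
  ultimately show False
    using opn finite_imp_not_open by blast
qed

definition gauss_poly :: "nat \<Rightarrow> nat \<Rightarrow> complex poly" where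
  "gauss_poly i j = monom 1 (i + j - 1) *
     (smult (of_nat i - of_nat j) P + smult (1 / 3) (monom 1 1 * pderiv P))"

lemma alpha_eq: "alpha t r i = form_dx t r (\<lambda>x y. x ^ i / y ^ 1)"
  and beta_eq: "beta t r j = form_dx t r (\<lambda>x y. x ^ j / y ^ 2)"
  by (simp_all add: alpha_def beta_def)

lemma alpha_section: "1 \<le> i \<Longrightarrow> i + 2 \<le> m \<Longrightarrow> alpha t r i \<in> H0_M t r"
  and beta_section: "1 \<le> j \<Longrightarrow> j + 2 \<le> 2 * m \<Longrightarrow> beta t r j \<in> H0_M t r"
  unfolding alpha_eq beta_eq by (rule form_dx_section; simp)+

text \<open>
  The pointwise algebra behind the formula for \<open>\<mu> (\<alpha> i \<wedge> \<beta> j)\<close>.  Here \<open>a, b, x, y\<close> are values and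
  \<open>a1, b1, x1, y1\<close> derivatives of the two components and of the coordinates.  Since
  \<open>\<alpha> i / \<beta> j = x^(i-j) y\<close>, hypothesis \<open>ab\<close> relates the components without reference to \<open>u\<close> or
  \<open>x1\<close>, and \<open>d\<close> is its derivative; so neither \<open>u'\<close> nor the second derivative of \<open>x\<close> enters.
\<close>

lemma wronskian_identity:
  fixes a b a1 b1 x y x1 y1 p p1 u :: complex
  assumes "x \<noteq> 0" and "1 \<le> i"
    and a: "a * u * y = x ^ i * x1" and b: "b * u * y ^ 2 = x ^ j * x1"
    and ab: "a * x ^ j = b * y * x ^ i"
    and d: "a1 * x ^ j + a * (of_nat j * x ^ (j - 1) * x1) =
            (b1 * y + b * y1) * x ^ i + b * y * (of_nat i * x ^ (i - 1) * x1)"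
    and p: "y ^ 3 = p" and p1: "3 * y ^ 2 * y1 = p1 * x1"
  shows "(a1 * b - a * b1) * u ^ 2 * p ^ 2 =
    x ^ (i + j - 1) * ((of_nat i - of_nat j) * p + 1 / 3 * (x * p1)) * x1 ^ 3"
proof -
  have pw: "of_nat n * x ^ (n - 1) * x = of_nat n * x ^ n" for n
    by (cases n) simp_all
  have "(a1 * b - a * b1) * x ^ (j + 1) = (a1 * x ^ j) * b * x - (a * x ^ j) * b1 * x"
    by (simp add: algebra_simps)
  also have "a1 * x ^ j = (b1 * y + b * y1) * x ^ i + b * y * (of_nat i * x ^ (i - 1) * x1)
      - a * (of_nat j * x ^ (j - 1) * x1)"
    using d by (simp add: eq_diff_eq)
  also have "(\<dots>) * b * x - (a * x ^ j) * b1 * x =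
      b ^ 2 * y1 * x ^ i * x + b ^ 2 * y * (of_nat i * x ^ (i - 1) * x) * x1
      - a * b * (of_nat j * x ^ (j - 1) * x) * x1"
    unfolding ab by (simp add: algebra_simps power2_eq_square)
  also have "\<dots> = b ^ 2 * y1 * x ^ i * x + b ^ 2 * y * of_nat i * x ^ i * x1
      - (a * x ^ j) * b * of_nat j * x1"
    unfolding pw by (simp add: algebra_simps)
  also have "\<dots> = b ^ 2 * x ^ i * (y1 * x + (of_nat i - of_nat j) * y * x1)"
    unfolding ab by (simp add: algebra_simps power2_eq_square)
  finally have W: "(a1 * b - a * b1) * x ^ (j + 1) =
      b ^ 2 * x ^ i * (y1 * x + (of_nat i - of_nat j) * y * x1)" .
  have "(a1 * b - a * b1) * u ^ 2 * p ^ 2 * x ^ (j + 1) =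
      ((a1 * b - a * b1) * x ^ (j + 1)) * u ^ 2 * y ^ 6"
    by (simp add: algebra_simps flip: p power_mult)
  also have "\<dots> = (b * u * y ^ 2) ^ 2 * x ^ i * (y ^ 2 * y1 * x + (of_nat i - of_nat j) * y ^ 3 * x1)"
    unfolding W by (simp add: algebra_simps power_numeral_reduce)
  also have "y ^ 2 * y1 = p1 * x1 / 3" using p1 by (simp add: field_simps)
  also have "(b * u * y ^ 2) ^ 2 * x ^ i * (p1 * x1 / 3 * x + (of_nat i - of_nat j) * y ^ 3 * x1) =
      x ^ (i + 2 * j) * ((of_nat i - of_nat j) * p + 1 / 3 * (x * p1)) * x1 ^ 3"
  proof -
    have "x ^ (i + 2 * j) = x ^ i * (x ^ j) ^ 2"
      by (simp add: power_add mult_2 power2_eq_square)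
    then show ?thesis
      unfolding b p by (simp add: algebra_simps power2_eq_square power3_eq_cube)
  qed
  also have "i + 2 * j = (i + j - 1) + (j + 1)"
    using \<open>1 \<le> i\<close> by simp
  also have "x ^ \<dots> = x ^ (i + j - 1) * x ^ (j + 1)"
    by (rule power_add)
  finally show ?thesis
    using \<open>x \<noteq> 0\<close> by (simp add: mult_ac)
qed

lemma represents_wronskian:
  assumes "1 \<le> i" "i + 2 \<le> m" "1 \<le> j" "j + 2 \<le> 2 * m"
  shows "represents (gauss_poly i j) (gauss_wronskian t r (alpha t r i) (beta t r j))"
  unfolding represents_def
proof (intro conjI allI impI ballI)
  let ?W = "gauss_wronskian t r (alpha t r i) (beta t r j)"
  have W: "?W \<in> H0_M2K t r"
    using assms by (intro gauss_wronskian_section alpha_section beta_section)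
  show "?W q = 0" if "q \<notin> patches t r" for q
    using that by (auto simp: gauss_wronskian_def split: prod.splits)
  fix D \<psi> u assume \<tau>: "trivialisation t r (D, \<psi>, u)"
  show "(\<lambda>z. ?W ((D, \<psi>, u), z)) holomorphic_on D"
    using W \<tau> by (rule sections_holomorphic)
  fix z assume z: "z \<in> D" "generic (\<psi> z)"
  define G where "G = {z\<in>D. generic (\<psi> z)}"
  have G: "open G" "z \<in> G" using open_generic_part[OF \<tau>] z by (auto simp: G_def)
  define a where "a = (\<lambda>\<zeta>. alpha t r i ((D, \<psi>, u), \<zeta>))"
  define b where "b = (\<lambda>\<zeta>. beta t r j ((D, \<psi>, u), \<zeta>))"
  define x where "x = coord_x \<circ> \<psi>"
  define y where "y = coord_y \<circ> \<psi>"
  have a: "a \<zeta> * u \<zeta> * y \<zeta> = x \<zeta> ^ i * deriv x \<zeta>" if "\<zeta> \<in> G" for \<zeta>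
    using form_dx_generic[OF \<tau>, of 1 i \<zeta>] assms that
    by (simp add: a_def x_def y_def G_def alpha_eq)
  have b: "b \<zeta> * u \<zeta> * y \<zeta> ^ 2 = x \<zeta> ^ j * deriv x \<zeta>" if "\<zeta> \<in> G" for \<zeta>
    using form_dx_generic[OF \<tau>, of 2 j \<zeta>] assms that
    by (simp add: b_def x_def y_def G_def beta_eq)
  have nz: "x \<zeta> \<noteq> 0" "y \<zeta> \<noteq> 0" "u \<zeta> \<noteq> 0" if "\<zeta> \<in> G" for \<zeta>
    using that u_nonzero[OF \<tau>] by (auto simp: x_def y_def G_def generic_def)
  have p: "y \<zeta> ^ 3 = poly P (x \<zeta>)" if "\<zeta> \<in> G" for \<zeta>
    using that generic_equation triv_curve[OF \<tau>] by (auto simp: x_def y_def G_def)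
  have ab: "a \<zeta> * x \<zeta> ^ j = b \<zeta> * y \<zeta> * x \<zeta> ^ i" if "\<zeta> \<in> G" for \<zeta>
  proof -
    have "(a \<zeta> * x \<zeta> ^ j) * (u \<zeta> * y \<zeta>) = (a \<zeta> * u \<zeta> * y \<zeta>) * x \<zeta> ^ j"
      by (simp add: mult_ac)
    also have "\<dots> = x \<zeta> ^ i * (b \<zeta> * u \<zeta> * y \<zeta> ^ 2)"
      unfolding a[OF that] b[OF that] by (simp add: mult_ac)
    also have "\<dots> = (b \<zeta> * y \<zeta> * x \<zeta> ^ i) * (u \<zeta> * y \<zeta>)"
      by (simp add: mult_ac power2_eq_square)
    finally show ?thesis using nz[OF that] by simp
  qed
  have da: "(a has_field_derivative deriv a z) (at z)"
    and db: "(b has_field_derivative deriv b z) (at z)"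
    unfolding a_def b_def
    using assms by (auto intro!: holomorphic_derivI[OF sections_holomorphic[OF _ \<tau>] triv_open[OF \<tau>] z(1)]
        alpha_section beta_section)
  have dx: "(x has_field_derivative deriv x z) (at z)"
    and dy: "(y has_field_derivative deriv y z) (at z)"
    unfolding x_def y_def
    using holomorphic_derivI[OF coord_x_holomorphic[OF \<tau>]] holomorphic_derivI[OF coord_y_holomorphic[OF \<tau>]]
      G unfolding G_def by blast+
  have dpow: "((\<lambda>\<zeta>. x \<zeta> ^ n) has_field_derivative of_nat n * x z ^ (n - 1) * deriv x z) (at z)" for n
    using DERIV_power[OF dx, of n] by (simp add: mult_ac)
  have "deriv a z * x z ^ j + a z * (of_nat j * x z ^ (j - 1) * deriv x z) =
      (deriv b z * y z + b z * deriv y z) * x z ^ i + b z * y z * (of_nat i * x z ^ (i - 1) * deriv x z)"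
  proof (rule DERIV_unique)
    show "((\<lambda>\<zeta>. a \<zeta> * x \<zeta> ^ j) has_field_derivative
        deriv a z * x z ^ j + a z * (of_nat j * x z ^ (j - 1) * deriv x z)) (at z)"
      by (rule DERIV_cong[OF DERIV_mult[OF da dpow]]) (simp add: mult_ac)
    have "((\<lambda>\<zeta>. b \<zeta> * y \<zeta> * x \<zeta> ^ i) has_field_derivative (deriv b z * y z + b z * deriv y z) * x z ^ i +
        b z * y z * (of_nat i * x z ^ (i - 1) * deriv x z)) (at z)"
      by (rule DERIV_cong[OF DERIV_mult[OF DERIV_mult[OF db dy] dpow]]) (simp add: algebra_simps)
    then show "((\<lambda>\<zeta>. a \<zeta> * x \<zeta> ^ j) has_field_derivative (deriv b z * y z + b z * deriv y z) * x z ^ i +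
        b z * y z * (of_nat i * x z ^ (i - 1) * deriv x z)) (at z)"
      by (rule has_field_derivative_transform_within_open[OF _ G]) (simp add: ab)
  qed
  moreover have "3 * y z ^ 2 * deriv y z = poly (pderiv P) (x z) * deriv x z"
  proof (rule DERIV_unique)
    show "((\<lambda>\<zeta>. y \<zeta> ^ 3) has_field_derivative 3 * y z ^ 2 * deriv y z) (at z)"
      using DERIV_power[OF dy, of 3] by (simp add: mult_ac)
    show "((\<lambda>\<zeta>. y \<zeta> ^ 3) has_field_derivative poly (pderiv P) (x z) * deriv x z) (at z)"
      by (rule has_field_derivative_transform_within_open[OF DERIV_chain2[OF poly_DERIV dx] G])
        (simp add: p)
  qed
  ultimately have "(deriv a z * b z - a z * deriv b z) * u z ^ 2 * poly P (x z) ^ 2 =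
    x z ^ (i + j - 1) * ((of_nat i - of_nat j) * poly P (x z) + 1 / 3 * (x z * poly (pderiv P) (x z)))
      * deriv x z ^ 3"
    using wronskian_identity[OF nz(1)[OF G(2)] assms(1) a[OF G(2)] b[OF G(2)] ab[OF G(2)] _ p[OF G(2)]]
    by blast
  moreover have "?W ((D, \<psi>, u), z) = deriv a z * b z - a z * deriv b z"
    using \<tau> z(1) by (simp add: gauss_wronskian_def patches_def a_def b_def)
  ultimately show "?W ((D, \<psi>, u), z) * u z ^ 2 * poly P (coord_x (\<psi> z)) ^ 2 =
      poly (gauss_poly i j) (coord_x (\<psi> z)) * deriv (coord_x \<circ> \<psi>) z ^ 3"
    by (simp add: gauss_poly_def poly_monom flip: x_def) (simp add: x_def)
qed


section \<open>The rank\<close>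

text \<open>
  Pairs with the same sum differ by \<open>(i - j) - (k - l) = 2 (i - k)\<close> in the coefficient of \<open>P\<close>.
\<close>

lemma gauss_poly_shift:
  assumes "i + j = k + l"
  shows "gauss_poly i j = gauss_poly k l + smult (2 * (of_nat i - of_nat k)) (monom 1 (k + l - 1) * P)"
proof -
  have "of_nat i + of_nat j = (of_nat k + of_nat l :: complex)"
    using assms by (metis of_nat_add)
  then have d: "of_nat i - of_nat j = (of_nat k - of_nat l) + 2 * (of_nat i - of_nat k :: complex)"
    by (simp add: algebra_simps)
  show ?thesis
    unfolding gauss_poly_def assms d
    by (simp only: smult_add_left distrib_left mult_smult_right mult_smult_left add_ac)
qed

text \<open>
  The pair \<open>P, P'\<close> is coprime, so \<open>P\<close> divides \<open>B\<close>, which has smaller degree.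
\<close>

lemma syzygy_trivial:
  assumes "P * A + pderiv P * B = 0" "degree B < r"
  shows "A = 0" "B = 0"
proof -
  show "B = 0"
  proof (rule ccontr)
    assume "B \<noteq> 0"
    have "t ` {1..r} \<subseteq> {x. poly B x = 0}"
    proof (clarify)
      fix k assume "k \<in> {1..r}"
      then have P: "poly P (t k) = 0" by (auto simp: poly_P)
      have "poly (P * A + pderiv P * B) (t k) = 0" by (simp add: assms(1))
      then show "poly B (t k) = 0"
        using P simple_roots_P[OF P] by simp
    qed
    then have "card (t ` {1..r}) \<le> card {x. poly B x = 0}"
      using poly_roots_finite[OF \<open>B \<noteq> 0\<close>] by (rule card_mono[rotated])
    also have "\<dots> \<le> degree B"
      using \<open>B \<noteq> 0\<close> by (rule card_poly_roots_bound)
    finally show False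
      using assms(2) inj_t by (simp add: card_image)
  qed
  then show "A = 0"
    using assms(1) degree_P r_ge by auto
qed

lemma smult_monom_mult: "smult c (monom 1 n * q) = q * monom (c :: complex) n"
proof -
  have "monom c n = smult c (monom 1 n)" by (simp add: smult_monom)
  then show ?thesis by (simp add: mult.commute)
qed

lemma coeff_sum_monom:
  fixes c :: "nat \<Rightarrow> complex"
  assumes "finite S" shows "coeff (\<Sum>s\<in>S. monom (c s) s) n = (if n \<in> S then c n else 0)"
  using assms by (simp add: coeff_sum)

text \<open>
  The family consists of one numerator for each sum \<open>s\<close> in \<open>A\<close> and of \<open>x^(s-1) P\<close> for each \<open>s\<close> in
  \<open>A'\<close>.  In a relation, the numbers \<open>b s / 3\<close> are the coefficients of the cofactor of \<open>P'\<close>, which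
  is zero; what is left is a multiple of \<open>P\<close> with the coefficients \<open>a s\<close>.
\<close>

lemma gauss_polys_independent:
  fixes a b :: "nat \<Rightarrow> complex"
  assumes A: "finite A" "A \<subseteq> {1..<r}" "\<And>s. s \<in> A \<Longrightarrow> i s + j s = s"
    and A': "finite A'" "A' \<subseteq> {1..}"
    and zero: "(\<Sum>s\<in>A. smult (b s) (gauss_poly (i s) (j s))) +
      (\<Sum>s\<in>A'. smult (a s) (monom 1 (s - 1) * P)) = 0"
  shows "s \<in> A \<Longrightarrow> b s = 0" and "s \<in> A' \<Longrightarrow> a s = 0"
proof -
  define B where "B = (\<Sum>s\<in>A. monom (b s) s)"
  define C where "C = (\<Sum>s\<in>A. monom (b s * (of_nat (i s) - of_nat (j s))) (s - 1))"
  define E where "E = (\<Sum>s\<in>A'. monom (a s) (s - 1))"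
  have g: "smult (b s) (gauss_poly (i s) (j s)) =
      P * monom (b s * (of_nat (i s) - of_nat (j s))) (s - 1) + smult (1 / 3) (pderiv P) * monom (b s) s"
    if "s \<in> A" for s
  proof -
    have "s \<ge> 1" using A(2) that by auto
    then have m: "monom (1::complex) (s - 1) * monom 1 1 = monom 1 s" by (simp add: mult_monom)
    have gp: "gauss_poly (i s) (j s) = smult (of_nat (i s) - of_nat (j s)) (P * monom 1 (s - 1)) +
        smult (1 / 3) (pderiv P * (monom 1 (s - 1) * monom 1 1))"
      unfolding gauss_poly_def A(3)[OF that] by (simp add: algebra_simps)
    have c: "monom c n = smult c (monom 1 n)" for c :: complex and n
      by (simp add: smult_monom)
    show ?thesis
      unfolding gp m c[of "b s * (of_nat (i s) - of_nat (j s))"] c[of "b s"]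
      by (simp add: smult_add_right mult_ac)
  qed
  have "(\<Sum>s\<in>A. smult (b s) (gauss_poly (i s) (j s))) = P * C + smult (1 / 3) (pderiv P) * B"
    unfolding B_def C_def sum_distrib_left sum.distrib[symmetric]
    by (intro sum.cong refl g)
  moreover have "(\<Sum>s\<in>A'. smult (a s) (monom 1 (s - 1) * P)) = P * E"
    unfolding E_def sum_distrib_left
    by (intro sum.cong refl smult_monom_mult)
  ultimately have "P * (C + E) + pderiv P * smult (1 / 3) B = 0"
    using zero by (simp add: algebra_simps)
  moreover have "degree (smult (1 / 3) B) < r"
  proof -
    have "degree B \<le> r - 1"
      using A(1,2) by (intro degree_le) (auto simp: B_def coeff_sum_monom)
    then show ?thesis using r_ge by simp
  qed
  ultimately have "C + E = 0" "smult (1 / 3) B = 0"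
    by (rule syzygy_trivial)+
  then have "B = 0" by simp
  then have b0: "b s = 0" if "s \<in> A" for s
    using coeff_sum_monom[OF A(1), of b s] that by (simp add: B_def)
  then show "s \<in> A \<Longrightarrow> b s = 0" .
  have "C = 0" unfolding C_def by (rule sum.neutral) (simp add: b0)
  then have "E = 0" using \<open>C + E = 0\<close> by simp
  assume s: "s \<in> A'"
  \<comment> \<open>multiplication by \<open>x\<close> turns the truncated exponents \<open>s - 1\<close> into \<open>s\<close>\<close>
  have "E * monom 1 1 = (\<Sum>s\<in>A'. monom (a s) s)"
    unfolding E_def sum_distrib_right using A'(2) by (intro sum.cong) (auto simp: mult_monom)
  then have "(\<Sum>s\<in>A'. monom (a s) s) = 0" using \<open>E = 0\<close> by simp
  then show "a s = 0"
    using coeff_sum_monom[OF A'(1), of a s] s by simp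
qed

definition W :: "nat \<Rightarrow> nat \<Rightarrow> bundle_section" where
  "W i j = gauss_wronskian t r (alpha t r i) (beta t r j)"

lemma gauss_image_span:
  "gauss_map t r ` mixed_wedge (W1 t r) (W2 t r) =
     cfun.span {W i j |i j. i \<in> {1..m - 2} \<and> j \<in> {1..2 * m - 2}}"
proof -
  have "(r - 6) div 3 = k - 2 \<and> (2 * r - 6) div 3 = 2 * k - 2" if "3 * k = r" for k
    using that by auto
  then have n: "(r - 6) div 3 = m - 2" "(2 * r - 6) div 3 = 2 * m - 2"
    using r_eq by blast+
  let ?S = "{wedge f h |f h. f \<in> alpha t r ` {1..m - 2} \<and> h \<in> beta t r ` {1..2 * m - 2}}"
  have lin: "Vector_Spaces.linear cscale cscale (gauss_map t r)"
    and val: "\<And>\<omega> \<eta>. \<omega> \<in> H0_M t r \<Longrightarrow> \<eta> \<in> H0_M t r \<Longrightarrow>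
      gauss_map t r (wedge \<omega> \<eta>) = gauss_wronskian t r \<omega> \<eta>"
    using is_gauss_map_gauss_map[of t r] unfolding is_gauss_map_def by blast+
  have val': "gauss_map t r (wedge (alpha t r i) (beta t r j)) = W i j"
    if "i \<in> {1..m - 2}" "j \<in> {1..2 * m - 2}" for i j
    unfolding W_def using that m_ge by (intro val alpha_section beta_section) auto
  have "gauss_map t r ` mixed_wedge (W1 t r) (W2 t r) = cfun.span (gauss_map t r ` ?S)"
    unfolding W1_def W2_def n mixed_wedge_span
    using cfun_pair.linear_span_image[OF lin, of ?S] by simp
  also have "gauss_map t r ` ?S = {W i j |i j. i \<in> {1..m - 2} \<and> j \<in> {1..2 * m - 2}}"
    (is "_ = ?T")
  proof
    show "gauss_map t r ` ?S \<subseteq> ?T" using val' by blast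
    show "?T \<subseteq> gauss_map t r ` ?S"
    proof
      fix \<sigma> assume "\<sigma> \<in> ?T"
      then obtain i j where ij: "i \<in> {1..m - 2}" "j \<in> {1..2 * m - 2}" "\<sigma> = W i j" by blast
      then have "\<sigma> = gauss_map t r (wedge (alpha t r i) (beta t r j))" by (simp add: val')
      with ij show "\<sigma> \<in> gauss_map t r ` ?S" by blast
    qed
  qed
  finally show ?thesis .
qed

text \<open>
  The basis consists of \<open>Y s\<close>, the value at one chosen pair with sum \<open>s\<close>, for \<open>2 \<le> s \<le> 3 m - 4\<close>, and
  of \<open>X s\<close>, half the difference of the values at two neighbouring pairs, which represents
  \<open>x^(s-1) P\<close>, for the sums \<open>3 \<le> s \<le> 3 m - 5\<close> that have more than one pair.
\<close>

lemma dim_span_wronskians: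
  assumes "m \<ge> 4"
  shows "cfun.dim (cfun.span {W i j |i j. i \<in> {1..m - 2} \<and> j \<in> {1..2 * m - 2}}) = 6 * m - 12"
    (is "cfun.dim (cfun.span ?T) = _")
proof -
  \<comment> \<open>the least \<open>i \<ge> 1\<close> for which \<open>s - i\<close> is at most \<open>2 m - 2\<close>; for \<open>s\<close> in \<open>A'\<close> its successor is admissible too\<close>
  define i0 where "i0 s = max 1 (s - (2 * m - 2))" for s
  define A where "A = {2..3 * m - 4}"
  define A' where "A' = {3..3 * m - 5}"
  have i0: "i0 s \<in> {1..m - 2}" "s - i0 s \<in> {1..2 * m - 2}" "i0 s + (s - i0 s) = s" if "s \<in> A" for s
    using that assms by (auto simp: i0_def A_def)
  have i0': "Suc (i0 s) \<in> {1..m - 2}" "s - i0 s - 1 \<in> {1..2 * m - 2}"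
      "Suc (i0 s) + (s - i0 s - 1) = s" if "s \<in> A'" for s
    using that assms by (auto simp: i0_def A'_def)
  have "A' \<subseteq> A" by (auto simp: A_def A'_def)
  have rep: "represents (gauss_poly i j) (W i j)" if "i \<in> {1..m - 2}" "j \<in> {1..2 * m - 2}" for i j
    unfolding W_def using that m_ge by (intro represents_wronskian) auto
  define Y where "Y s = W (i0 s) (s - i0 s)" for s
  define X where "X s = cscale (1 / 2) (W (Suc (i0 s)) (s - i0 s - 1) - Y s)" for s
  have repY: "represents (gauss_poly (i0 s) (s - i0 s)) (Y s)" if "s \<in> A" for s
    unfolding Y_def using i0[OF that] by (intro rep)
  have repX: "represents (monom 1 (s - 1) * P) (X s)" if "s \<in> A'" for s
  proof -
    have s: "s \<in> A" using that \<open>A' \<subseteq> A\<close> by blast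
    have "gauss_poly (Suc (i0 s)) (s - i0 s - 1) =
        gauss_poly (i0 s) (s - i0 s) + smult 2 (monom 1 (s - 1) * P)"
      using gauss_poly_shift[of "Suc (i0 s)" "s - i0 s - 1" "i0 s" "s - i0 s"] i0'(3)[OF that] i0(3)[OF s]
      by simp
    then have "monom 1 (s - 1) * P = smult (1 / 2)
        (gauss_poly (Suc (i0 s)) (s - i0 s - 1) - gauss_poly (i0 s) (s - i0 s))"
      by simp
    then show ?thesis
      unfolding X_def using i0'[OF that] s
      by (auto intro!: represents_scale represents_diff rep repY)
  qed
  define v where "v = case_sum Y X"
  define p where "p = case_sum (\<lambda>s. gauss_poly (i0 s) (s - i0 s)) (\<lambda>s. monom 1 (s - 1) * P)"
  let ?K = "A <+> A'"
  have fin: "finite A" "finite A'" by (auto simp: A_def A'_def)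
  have repv: "represents (p k) (v k)" if "k \<in> ?K" for k
    using that repX repY by (auto simp: p_def v_def)
  have "cfun.dim (cfun.span (v ` ?K)) = card ?K"
  proof (rule dim_span_family)
    fix c k assume c: "(\<Sum>k\<in>?K. cscale (c k) (v k)) = 0" and k: "k \<in> ?K"
    have "represents (\<Sum>k\<in>?K. smult (c k) (p k)) 0"
      using represents_sum[of ?K p v c] repv unfolding c by blast
    then have "(\<Sum>k\<in>?K. smult (c k) (p k)) = 0"
      by (rule represents_zero_imp_poly_zero)
    then have z: "(\<Sum>s\<in>A. smult (c (Inl s)) (gauss_poly (i0 s) (s - i0 s))) +
        (\<Sum>s\<in>A'. smult (c (Inr s)) (monom 1 (s - 1) * P)) = 0"
      by (simp add: sum.Plus fin p_def)
    have "A \<subseteq> {1..<r}" "A' \<subseteq> {1..}" by (use r_eq assms in \<open>auto simp: A_def A'_def\<close>)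
    note ind = gauss_polys_independent[OF fin(1) this(1) i0(3) fin(2) this(2) z]
    show "c k = 0" using k ind by blast
  qed (use fin in simp)
  moreover have "cfun.span (v ` ?K) = cfun.span ?T"
  proof (rule cfun.span_eq[THEN iffD2], intro conjI subsetI)
    have W_span: "W i j \<in> cfun.span ?T" if "i \<in> {1..m - 2}" "j \<in> {1..2 * m - 2}" for i j
      using that by (intro cfun.span_base) blast
    have Y_span: "Y s \<in> cfun.span ?T" if "s \<in> A" for s
      unfolding Y_def using i0[OF that] by (intro W_span)
    have X_span: "X s \<in> cfun.span ?T" if "s \<in> A'" for s
      unfolding X_def using i0'[OF that] Y_span that \<open>A' \<subseteq> A\<close>
      by (intro cfun.span_scale cfun.span_diff W_span) auto
    show "\<sigma> \<in> cfun.span ?T" if "\<sigma> \<in> v ` ?K" for \<sigma>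
      using that X_span Y_span by (auto simp: v_def)
    fix \<sigma> assume "\<sigma> \<in> ?T"
    then obtain i j where ij: "i \<in> {1..m - 2}" "j \<in> {1..2 * m - 2}" and \<sigma>: "\<sigma> = W i j" by blast
    define s where "s = i + j"
    have s: "s \<in> A" using ij assms by (auto simp: s_def A_def)
    have Y_in: "Y s \<in> cfun.span (v ` ?K)"
      using s by (intro cfun.span_base image_eqI[of _ _ "Inl s"]) (auto simp: v_def)
    show "\<sigma> \<in> cfun.span (v ` ?K)"
    proof (cases "s \<in> A'")
      case True
      have "represents (gauss_poly (i0 s) (s - i0 s) + smult (2 * (of_nat i - of_nat (i0 s))) (monom 1 (s - 1) * P))
          (Y s + cscale (2 * (of_nat i - of_nat (i0 s))) (X s))"
        by (intro represents_add represents_scale repY repX s True)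
      moreover have "gauss_poly i j =
          gauss_poly (i0 s) (s - i0 s) + smult (2 * (of_nat i - of_nat (i0 s))) (monom 1 (s - 1) * P)"
        using gauss_poly_shift[of i j "i0 s" "s - i0 s"] i0(3)[OF s] by (simp add: s_def)
      ultimately have "\<sigma> = Y s + cscale (2 * (of_nat i - of_nat (i0 s))) (X s)"
        using rep[OF ij] represents_unique by (simp add: \<sigma>)
      moreover have "X s \<in> cfun.span (v ` ?K)"
        using True by (intro cfun.span_base image_eqI[of _ _ "Inr s"]) (auto simp: v_def)
      ultimately show ?thesis
        using Y_in by (simp add: cfun.span_add cfun.span_scale)
    next
      case False
      \<comment> \<open>the extreme sums \<open>2\<close> and \<open>3 m - 4\<close> have only one pair\<close>
      then have "i = i0 s" "j = s - i0 s"
        using ij s assms by (auto simp: s_def A_def A'_def i0_def)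
      then show ?thesis using Y_in by (simp add: \<sigma> Y_def)
    qed
  qed
  moreover have "card ?K = 6 * m - 12"
    using assms fin by (simp add: card_Plus A_def A'_def)
  ultimately show ?thesis by simp
qed

end

theorem theorem2p14:
  fixes t :: "nat \<Rightarrow> complex" and r :: nat
  assumes "inj_on t {1..r}" and "t 1 = 0"
    and "3 dvd r" and "r \<ge> 6" and "r \<noteq> 9"
  shows "int (cfun.dim (gauss_map t r ` mixed_wedge (W1 t r) (W2 t r))) = 2 * int r - 12"
proof -
  interpret triple_cover t r
    using assms by unfold_locales
  show ?thesis
  proof (cases "r = 6")
    case True
    then have "m = 2" using r_eq by linarith
    then have "{W i j |i j. i \<in> {1..m - 2} \<and> j \<in> {1..2 * m - 2}} = {}" by auto
    then have "cfun.dim (cfun.span {W i j |i j. i \<in> {1..m - 2} \<and> j \<in> {1..2 * m - 2}}) = 0"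
      using cfun.dim_span_eq_card_independent[OF cfun.independent_empty] by (simp only: card.empty)
    then show ?thesis
      unfolding gauss_image_span using True by simp
  next
    case False
    then have "m \<ge> 4" using r_eq assms(4,5) by presburger
    then show ?thesis
      unfolding gauss_image_span dim_span_wronskians[OF \<open>m \<ge> 4\<close>] using r_eq by linarith
  qed
qed

end
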